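(* Let $\mu\in(-\tfrac12,\infty)$, $a\in\mathbb R$, and let $\nu$ be a complex Borel measure on $R_a:=[a,\infty)$ such that $\nu$ is finite if $\mu\in[0,\infty)$, and $\int_{R_a}(|t|^{-\mu}+1)\,|\nu|(dt)<\infty$ if $\mu\in(-\tfrac12,0)$. Assume that $\nu$ is an analytic measure, that is, $$\int_{R_a}\boldsymbol e_\mu(ixt)\,\nu(dt)=0\qquad\text{for all real }x.$$ Then $\nu$ is absolutely continuous with respect to linear Lebesgue measure.
   Context: For $\mu>-\frac12$, $\boldsymbol e_\mu$ is the entire function $\boldsymbol e_\mu(x)=\sum_{m=0}^\infty x^m/\gamma_\mu(m)$, where for $m=0,1,2,\dots$, $\gamma_\mu(2m)=\frac{2^{2m}m!\,\Gamma(m+\mu+\frac12)}{\Gamma(\mu+\frac12)}$ and $\gamma_\mu(2m+1)=\frac{2^{2m+1}m!\,\Gamma(m+\mu+\frac32)}{\Gamma(\mu+\frac12)}$. (So $\boldsymbol e_0(x)=e^x$.) *)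

theory Defs
  imports "HOL-Analysis.Analysis"
begin

definition dunkl_gamma :: "real \<Rightarrow> nat \<Rightarrow> real" where
  "dunkl_gamma \<mu> n =
     (if even n
      then 2 ^ n * fact (n div 2) * Gamma (real (n div 2) + \<mu> + 1/2) / Gamma (\<mu> + 1/2)
      else 2 ^ n * fact (n div 2) * Gamma (real (n div 2) + \<mu> + 3/2) / Gamma (\<mu> + 1/2))"

definition dunkl_exp :: "real \<Rightarrow> complex \<Rightarrow> complex" where
  "dunkl_exp \<mu> z = (\<Sum>m. z ^ m / complex_of_real (dunkl_gamma \<mu> m))"

text \<open>
  A complex measure is a countably additive set function on \<open>sets M\<close>; only the \<open>\<sigma>\<close>-algebra of
  \<open>M\<close> is used, and values of \<open>\<nu>\<close> off \<open>sets M\<close> are irrelevant.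
\<close>

definition complex_measure :: "'a measure \<Rightarrow> ('a set \<Rightarrow> complex) \<Rightarrow> bool" where
  "complex_measure M \<nu> \<longleftrightarrow> \<nu> {} = 0 \<and>
     (\<forall>A. range A \<subseteq> sets M \<longrightarrow> disjoint_family A \<longrightarrow> (\<lambda>n::nat. \<nu> (A n)) sums \<nu> (\<Union>n. A n))"

text \<open>
  Finite partitions give the same supremum as countable ones.
\<close>

definition total_variation_on :: "'a measure \<Rightarrow> ('a set \<Rightarrow> complex) \<Rightarrow> 'a set \<Rightarrow> ennreal" where
  "total_variation_on M \<nu> E =
     (SUP P \<in> {P. finite P \<and> P \<subseteq> sets M \<and> disjoint P \<and> \<Union>P = E}. \<Sum>A\<in>P. ennreal (cmod (\<nu> A)))"

text \<open>
  \<open>measure_of\<close> returns the zero measure if the given set function is not countably additive;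
  the lemmas \<open>emeasure_total_variation\<close> and \<open>emeasure_positive_part\<close> below show that this does
  not happen for complex measures.
\<close>

definition total_variation :: "'a measure \<Rightarrow> ('a set \<Rightarrow> complex) \<Rightarrow> 'a measure" where
  "total_variation M \<nu> = measure_of (space M) (sets M) (total_variation_on M \<nu>)"

text \<open>The positive part of the Jordan decomposition of a signed measure \<open>\<sigma>\<close>; the negative part
  is the positive part of \<open>- \<sigma>\<close>.\<close>

definition positive_part_on :: "'a measure \<Rightarrow> ('a set \<Rightarrow> real) \<Rightarrow> 'a set \<Rightarrow> ennreal" where
  "positive_part_on M \<sigma> E = (SUP F \<in> {F \<in> sets M. F \<subseteq> E}. ennreal (\<sigma> F))"

definition positive_part :: "'a measure \<Rightarrow> ('a set \<Rightarrow> real) \<Rightarrow> 'a measure" where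
  "positive_part M \<sigma> = measure_of (space M) (sets M) (positive_part_on M \<sigma>)"

text \<open>
  The integral is meaningful for \<open>f\<close> integrable with respect to the total variation; the Bochner
  integrals below are \<open>0\<close> by convention for non-integrable \<open>f\<close>.
\<close>

definition signed_integral :: "'a measure \<Rightarrow> ('a set \<Rightarrow> real) \<Rightarrow> ('a \<Rightarrow> complex) \<Rightarrow> complex" where
  "signed_integral M \<sigma> f =
     (LINT t|positive_part M \<sigma>. f t) - (LINT t|positive_part M (\<lambda>E. - \<sigma> E). f t)"

definition complex_measure_integral ::
    "'a measure \<Rightarrow> ('a set \<Rightarrow> complex) \<Rightarrow> ('a \<Rightarrow> complex) \<Rightarrow> complex" where
  "complex_measure_integral M \<nu> f =
     signed_integral M (\<lambda>E. Re (\<nu> E)) f + \<i> * signed_integral M (\<lambda>E. Im (\<nu> E)) f"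

text \<open>Absolute continuity of a complex measure \<open>\<nu>\<close> with respect to a positive measure \<open>N\<close>; the
  library's \<open>absolutely_continuous\<close> only covers positive measures.\<close>

definition complex_absolutely_continuous :: "'a measure \<Rightarrow> ('a set \<Rightarrow> complex) \<Rightarrow> bool" where
  "complex_absolutely_continuous N \<nu> \<longleftrightarrow> (\<forall>E\<in>null_sets N. \<nu> E = 0)"

lemma measure_of_superadditive:
  fixes g :: "'a set \<Rightarrow> ennreal"
  assumes g0: "g {} = 0"
    and super: "\<And>A B. A \<in> sets M \<Longrightarrow> B \<in> sets M \<Longrightarrow> A \<inter> B = {} \<Longrightarrow> g A + g B \<le> g (A \<union> B)"
    and sub: "\<And>A. range A \<subseteq> sets M \<Longrightarrow> disjoint_family A \<Longrightarrow> g (\<Union>n::nat. A n) \<le> (\<Sum>n. g (A n))"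
    and E: "E \<in> sets M"
  shows "emeasure (measure_of (space M) (sets M) g) E = g E"
proof (rule emeasure_measure_of_sigma)
  show "sigma_algebra (space M) (sets M)" by (rule sets.sigma_algebra_axioms)
  show "positive (sets M) g" using g0 by (simp add: positive_def)
  show "E \<in> sets M" by fact
  show "countably_additive (sets M) g"
  proof (rule countably_additiveI)
    fix A :: "nat \<Rightarrow> 'a set"
    assume A: "range A \<subseteq> sets M" "disjoint_family A"
    have fin: "(\<Sum>i<n. g (A i)) \<le> g (\<Union>i<n. A i)" for n
    proof (induction n)
      case 0
      then show ?case using g0 by simp
    next
      case (Suc n)
      have "(\<Union>i<n. A i) \<inter> A n = {}"
        using disjoint_family_onD[OF A(2), of _ n] by fastforce
      then have "g (\<Union>i<n. A i) + g (A n) \<le> g ((\<Union>i<n. A i) \<union> A n)"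
        using A(1) by (intro super) auto
      moreover have "(\<Union>i<Suc n. A i) = (\<Union>i<n. A i) \<union> A n"
        by (auto simp: less_Suc_eq)
      ultimately show ?case
        using order_trans[OF add_right_mono[OF Suc, of "g (A n)"]] by simp
    qed
    have mono: "g B \<le> g C" if "B \<in> sets M" "C \<in> sets M" "B \<subseteq> C" for B C
    proof -
      have "g B \<le> g B + g (C - B)" by simp
      also have "\<dots> \<le> g (B \<union> (C - B))" using that by (intro super) auto
      also have "B \<union> (C - B) = C" using that by auto
      finally show ?thesis .
    qed
    have "(\<Sum>n. g (A n)) \<le> g (\<Union>n. A n)"
    proof (rule suminf_le_const)
      show "(\<Sum>i<n. g (A i)) \<le> g (\<Union>n. A n)" for n
        by (rule order_trans[OF fin mono]) (use A in auto)
    qed simp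
    then show "(\<Sum>n. g (A n)) = g (\<Union>n. A n)"
      using sub[OF A] by (rule antisym)
  qed
qed

lemma complex_measure_split:
  assumes "complex_measure M \<nu>" "range A \<subseteq> sets M" "disjoint_family A" "F \<in> sets M"
    "F \<subseteq> (\<Union>n::nat. A n)"
  shows "(\<lambda>n. \<nu> (F \<inter> A n)) sums \<nu> F"
proof -
  have "range (\<lambda>n. F \<inter> A n) \<subseteq> sets M" using assms by auto
  moreover have "disjoint_family (\<lambda>n. F \<inter> A n)"
    using assms(3) by (auto simp: disjoint_family_on_def)
  moreover have "(\<Union>n. F \<inter> A n) = F" using assms by auto
  ultimately show ?thesis using assms(1) unfolding complex_measure_def by metis
qed

lemma complex_measure_Un:
  assumes "complex_measure M \<nu>" "A \<in> sets M" "B \<in> sets M" "A \<inter> B = {}"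
  shows "\<nu> (A \<union> B) = \<nu> A + \<nu> B"
proof -
  have "range (binaryset A B) \<subseteq> sets M" "disjoint_family (binaryset A B)"
    using assms by (auto simp: binaryset_def disjoint_family_on_def)
  then have "(\<lambda>n. \<nu> (binaryset A B n)) sums \<nu> (\<Union>n. binaryset A B n)"
    using assms(1) unfolding complex_measure_def by blast
  moreover have "(\<lambda>n. \<nu> (binaryset A B n)) sums (\<nu> A + \<nu> B)"
    using assms by (intro binaryset_sums) (auto simp: complex_measure_def)
  ultimately show ?thesis by (metis UN_binaryset_eq sums_unique2)
qed

lemma ennreal_norm_sums_le:
  fixes f :: "nat \<Rightarrow> 'b::real_normed_vector"
  assumes "f sums s"
  shows "ennreal (norm s) \<le> (\<Sum>n. ennreal (norm (f n)))"
proof (rule LIMSEQ_le_const2)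
  show "(\<lambda>n. ennreal (norm (\<Sum>i<n. f i))) \<longlonglongrightarrow> ennreal (norm s)"
    using assms unfolding sums_def by (intro tendsto_ennrealI tendsto_norm)
  have "ennreal (norm (\<Sum>i<n. f i)) \<le> (\<Sum>n. ennreal (norm (f n)))" for n
  proof -
    have "ennreal (norm (\<Sum>i<n. f i)) \<le> ennreal (\<Sum>i<n. norm (f i))"
      by (intro ennreal_leI norm_sum)
    also have "\<dots> = (\<Sum>i<n. ennreal (norm (f i)))" by (simp add: sum_ennreal)
    also have "\<dots> \<le> (\<Sum>n. ennreal (norm (f n)))" by (intro sum_le_suminf) auto
    finally show ?thesis .
  qed
  then show "\<exists>N. \<forall>n\<ge>N. ennreal (norm (\<Sum>i<n. f i)) \<le> (\<Sum>n. ennreal (norm (f n)))" by blast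
qed

lemma ennreal_sums_le:
  fixes f :: "nat \<Rightarrow> real"
  assumes "f sums s"
  shows "ennreal s \<le> (\<Sum>n. ennreal (f n))"
proof (rule LIMSEQ_le_const2)
  show "(\<lambda>n. ennreal (\<Sum>i<n. f i)) \<longlonglongrightarrow> ennreal s"
    using assms unfolding sums_def by (intro tendsto_ennrealI)
  have "ennreal (\<Sum>i<n. f i) \<le> (\<Sum>n. ennreal (f n))" for n
  proof -
    have "ennreal (\<Sum>i<n. f i) \<le> ennreal (\<Sum>i<n. max 0 (f i))"
      by (intro ennreal_leI sum_mono) auto
    also have "\<dots> = (\<Sum>i<n. ennreal (max 0 (f i)))" by (subst sum_ennreal) auto
    also have "\<dots> = (\<Sum>i<n. ennreal (f i))" by (simp add: ennreal_max_0)
    also have "\<dots> \<le> (\<Sum>n. ennreal (f n))" by (intro sum_le_suminf) auto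
    finally show ?thesis .
  qed
  then show "\<exists>N. \<forall>n\<ge>N. ennreal (\<Sum>i<n. f i) \<le> (\<Sum>n. ennreal (f n))" by blast
qed

lemma ennreal_SUP_add_le:
  fixes f g :: "'b \<Rightarrow> ennreal"
  assumes "I \<noteq> {}" "J \<noteq> {}" "\<And>i j. i \<in> I \<Longrightarrow> j \<in> J \<Longrightarrow> f i + g j \<le> c"
  shows "(SUP i\<in>I. f i) + (SUP j\<in>J. g j) \<le> c"
proof -
  have "f i + (SUP j\<in>J. g j) \<le> c" if "i \<in> I" for i
    using assms that by (subst ennreal_SUP_add_right) (auto intro!: SUP_least)
  then show ?thesis
    using assms by (subst ennreal_SUP_add_left[symmetric]) (auto intro!: SUP_least)
qed

lemma emeasure_total_variation:
  assumes "complex_measure M \<nu>" "E \<in> sets M"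
  shows "emeasure (total_variation M \<nu>) E = total_variation_on M \<nu> E"
  unfolding total_variation_def
proof (rule measure_of_superadditive[OF _ _ _ assms(2)])
  have [simp]: "\<nu> {} = 0" using assms by (simp add: complex_measure_def)
  show "total_variation_on M \<nu> {} = 0"
  proof -
    have "(\<Sum>X\<in>P. ennreal (cmod (\<nu> X))) \<le> 0"
      if "P \<in> {P. finite P \<and> P \<subseteq> sets M \<and> disjoint P \<and> \<Union>P = {}}" for P
    proof -
      have "\<forall>X\<in>P. X = {}" using that by simp
      then show ?thesis by (subst sum.neutral) auto
    qed
    then have "total_variation_on M \<nu> {} \<le> 0"
      unfolding total_variation_on_def by (rule SUP_least)
    then show ?thesis by simp
  qed
  show "total_variation_on M \<nu> A + total_variation_on M \<nu> B \<le> total_variation_on M \<nu> (A \<union> B)"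
    if AB: "A \<in> sets M" "B \<in> sets M" "A \<inter> B = {}" for A B
    unfolding total_variation_on_def[of _ _ A] total_variation_on_def[of _ _ B]
  proof (rule ennreal_SUP_add_le)
    show "{P. finite P \<and> P \<subseteq> sets M \<and> disjoint P \<and> \<Union>P = A} \<noteq> {}"
      using AB by (intro ex_in_conv[THEN iffD1] exI[of _ "{A}"]) auto
    show "{P. finite P \<and> P \<subseteq> sets M \<and> disjoint P \<and> \<Union>P = B} \<noteq> {}"
      using AB by (intro ex_in_conv[THEN iffD1] exI[of _ "{B}"]) auto
    fix P Q
    assume P: "P \<in> {P. finite P \<and> P \<subseteq> sets M \<and> disjoint P \<and> \<Union>P = A}"
      and Q: "Q \<in> {P. finite P \<and> P \<subseteq> sets M \<and> disjoint P \<and> \<Union>P = B}"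
    have "ennreal (cmod (\<nu> X)) = 0" if "X \<in> P \<inter> Q" for X
    proof -
      have "X \<subseteq> A" "X \<subseteq> B" using that P Q by auto
      then have "X = {}" using AB by auto
      then show ?thesis by simp
    qed
    then have "(\<Sum>X\<in>P. ennreal (cmod (\<nu> X))) + (\<Sum>X\<in>Q. ennreal (cmod (\<nu> X)))
        = (\<Sum>X\<in>P \<union> Q. ennreal (cmod (\<nu> X)))"
      using P Q by (intro sum.union_inter_neutral[symmetric]) auto
    also have "\<dots> \<le> total_variation_on M \<nu> (A \<union> B)"
      unfolding total_variation_on_def
    proof (rule SUP_upper)
      have "disjoint (P \<union> Q)" using P Q AB by (intro disjoint_union) auto
      then show "P \<union> Q \<in> {P. finite P \<and> P \<subseteq> sets M \<and> disjoint P \<and> \<Union>P = A \<union> B}"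
        using P Q by auto
    qed
    finally show "(\<Sum>X\<in>P. ennreal (cmod (\<nu> X))) + (\<Sum>X\<in>Q. ennreal (cmod (\<nu> X)))
        \<le> total_variation_on M \<nu> (A \<union> B)" .
  qed
  show "total_variation_on M \<nu> (\<Union>n. A n) \<le> (\<Sum>n. total_variation_on M \<nu> (A n))"
    if A: "range A \<subseteq> sets M" "disjoint_family A" for A :: "nat \<Rightarrow> 'a set"
    unfolding total_variation_on_def[of _ _ "\<Union>n. A n"]
  proof (rule SUP_least)
    fix P assume P: "P \<in> {P. finite P \<and> P \<subseteq> sets M \<and> disjoint P \<and> \<Union>P = (\<Union>n. A n)}"
    have "(\<Sum>X\<in>P. ennreal (cmod (\<nu> X))) \<le> (\<Sum>X\<in>P. \<Sum>n. ennreal (cmod (\<nu> (X \<inter> A n))))"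
      using P by (intro sum_mono ennreal_norm_sums_le complex_measure_split[OF assms(1) A]) auto
    also have "\<dots> = (\<Sum>n. \<Sum>X\<in>P. ennreal (cmod (\<nu> (X \<inter> A n))))"
      by (rule suminf_sum[symmetric]) simp
    also have "\<dots> \<le> (\<Sum>n. total_variation_on M \<nu> (A n))"
    proof (rule suminf_le)
      fix n
      let ?Q = "(\<lambda>X. X \<inter> A n) ` P"
      have "(\<Sum>X\<in>P. ennreal (cmod (\<nu> (X \<inter> A n)))) = (\<Sum>Y\<in>?Q. ennreal (cmod (\<nu> Y)))"
      proof (rule sum.reindex_nontrivial[symmetric, unfolded o_def])
        show "finite P" using P by simp
        fix X Y assume "X \<in> P" "Y \<in> P" "X \<noteq> Y" "X \<inter> A n = Y \<inter> A n"
        then have "X \<inter> Y = {}" using P by (auto simp: disjoint_def)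
        then have "X \<inter> A n = {}" using \<open>X \<inter> A n = Y \<inter> A n\<close> by blast
        then show "ennreal (cmod (\<nu> (X \<inter> A n))) = 0" by simp
      qed
      also have "\<dots> \<le> total_variation_on M \<nu> (A n)"
        unfolding total_variation_on_def
      proof (rule SUP_upper)
        have "disjoint ?Q" using P by (auto simp: disjoint_def)
        moreover have "\<Union>?Q = A n" using P by auto
        ultimately show "?Q \<in> {P. finite P \<and> P \<subseteq> sets M \<and> disjoint P \<and> \<Union>P = A n}"
          using P A by auto
      qed
      finally show "(\<Sum>X\<in>P. ennreal (cmod (\<nu> (X \<inter> A n)))) \<le> total_variation_on M \<nu> (A n)" .
    qed auto
    finally show "(\<Sum>X\<in>P. ennreal (cmod (\<nu> X))) \<le> (\<Sum>n. total_variation_on M \<nu> (A n))" .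
  qed
qed

lemma emeasure_positive_part:
  assumes \<nu>: "complex_measure M \<nu>" and E: "E \<in> sets M"
    and L: "bounded_linear (L :: complex \<Rightarrow> real)"
  shows "emeasure (positive_part M (\<lambda>E. L (\<nu> E))) E = positive_part_on M (\<lambda>E. L (\<nu> E)) E"
  unfolding positive_part_def
proof (rule measure_of_superadditive[OF _ _ _ E])
  let ?g = "positive_part_on M (\<lambda>E. L (\<nu> E))"
  interpret L: bounded_linear L by fact
  have [simp]: "L (\<nu> {}) = 0" using \<nu> by (simp add: complex_measure_def L.zero)
  show "?g {} = 0"
    by (auto simp: positive_part_on_def intro!: antisym SUP_least)
  show "?g A + ?g B \<le> ?g (A \<union> B)"
    if AB: "A \<in> sets M" "B \<in> sets M" "A \<inter> B = {}" for A B
    unfolding positive_part_on_def[of _ _ A] positive_part_on_def[of _ _ B]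
  proof (rule ennreal_SUP_add_le)
    fix F G assume F: "F \<in> {F \<in> sets M. F \<subseteq> A}" and G: "G \<in> {F \<in> sets M. F \<subseteq> B}"
    define F' where "F' = (if L (\<nu> F) \<ge> 0 then F else {})"
    define G' where "G' = (if L (\<nu> G) \<ge> 0 then G else {})"
    have FG: "F' \<in> sets M" "F' \<subseteq> A" "G' \<in> sets M" "G' \<subseteq> B"
      using F G by (auto simp: F'_def G'_def)
    have "ennreal (L (\<nu> F)) = ennreal (L (\<nu> F'))" "L (\<nu> F') \<ge> 0"
      "ennreal (L (\<nu> G)) = ennreal (L (\<nu> G'))" "L (\<nu> G') \<ge> 0"
      by (auto simp: F'_def G'_def ennreal_neg)
    then have "ennreal (L (\<nu> F)) + ennreal (L (\<nu> G)) = ennreal (L (\<nu> F') + L (\<nu> G'))"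
      by simp
    also have "L (\<nu> F') + L (\<nu> G') = L (\<nu> (F' \<union> G'))"
      using FG AB by (subst complex_measure_Un[OF \<nu>]) (auto simp: L.add)
    also have "ennreal \<dots> \<le> ?g (A \<union> B)"
      unfolding positive_part_on_def using FG by (intro SUP_upper) auto
    finally show "ennreal (L (\<nu> F)) + ennreal (L (\<nu> G)) \<le> ?g (A \<union> B)" .
  qed auto
  show "?g (\<Union>n. A n) \<le> (\<Sum>n. ?g (A n))"
    if A: "range A \<subseteq> sets M" "disjoint_family A" for A :: "nat \<Rightarrow> 'a set"
    unfolding positive_part_on_def[of _ _ "\<Union>n. A n"]
  proof (rule SUP_least)
    fix F assume F: "F \<in> {F \<in> sets M. F \<subseteq> (\<Union>n. A n)}"
    have "(\<lambda>n. L (\<nu> (F \<inter> A n))) sums L (\<nu> F)"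
      using F by (intro L.sums complex_measure_split[OF \<nu> A]) auto
    then have "ennreal (L (\<nu> F)) \<le> (\<Sum>n. ennreal (L (\<nu> (F \<inter> A n))))"
      by (rule ennreal_sums_le)
    also have "\<dots> \<le> (\<Sum>n. ?g (A n))"
      unfolding positive_part_on_def using F A
      by (intro suminf_le SUP_upper) auto
    finally show "ennreal (L (\<nu> F)) \<le> (\<Sum>n. ?g (A n))" .
  qed
qed

end

theory Submission
  imports Defs
begin

text \<open>
  The hypothesis, holding for all real \<open>x\<close>, says that the Dunkl transform of \<open>\<nu>\<close> vanishes
  identically, and this forces \<open>\<nu> = 0\<close>; absolute continuity follows. So the content is the
  injectivity of the Dunkl transform (\<open>dunkl_transform_injective\<close>).

  Write \<open>e\<^sub>\<mu>(iy) = A(y) + i B(y)\<close> with \<open>A\<close> even and \<open>B\<close> odd (\<open>dunkl_cos\<close>, \<open>dunkl_sin\<close>). Because of the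
  parities, the hypothesis at \<open>x\<close> and \<open>-x\<close> yields that \<open>A(xt)\<close> and \<open>B(xt)\<close> have integral zero with
  respect to both \<open>Re \<nu>\<close> and \<open>Im \<nu>\<close>. Integrating these identities in \<open>u > 0\<close> at \<open>x = c * sqrt u\<close>
  against \<open>u powr (\<mu> - 1/2) * exp (-u)\<close> and \<open>u powr \<mu> * exp (-u)\<close> replaces the kernels by constant
  multiples of \<open>exp (- (ct)\<^sup>2 / 4)\<close> and \<open>c t exp (- (ct)\<^sup>2 / 4)\<close>, as termwise integration of the power
  series shows (\<open>dunkl_cos_gamma_integral\<close>, \<open>dunkl_sin_gamma_integral\<close>). With \<open>c = 2 * sqrt n\<close>, the
  functions \<open>exp (- n t\<^sup>2)\<close> and \<open>t exp (- n t\<^sup>2)\<close> have integral zero. In the variable \<open>exp (- t\<^sup>2)\<close>,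
  which ranges over \<open>(0, 1]\<close>, these are moments, and the Weierstrass approximation theorem shows that
  the measure vanishes (\<open>gaussian_moments_zero_imp_AE_zero\<close>).

  Fubini's theorem, and the very existence of the integrals, require the bound
  \<open>\<bar>e\<^sub>\<mu>(iy)\<bar> \<le> C (1 + \<bar>y\<bar> powr max 0 (-\<mu>))\<close>, which matches the integrability condition on \<open>\<nu>\<close>. It is proved
  by energy estimates for the first-order system satisfied by \<open>A\<close> and \<open>B\<close> (\<open>dunkl_cos_sin_bound\<close>).
\<close>

section \<open>The even and odd part of the Dunkl exponential on the imaginary axis\<close>

lemma dunkl_gamma_0: "\<mu> > -1/2 \<Longrightarrow> dunkl_gamma \<mu> 0 = 1"
  using Gamma_real_pos[of "\<mu> + 1/2"] by (simp add: dunkl_gamma_def less_imp_neq[symmetric])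

lemma dunkl_gamma_Suc:
  assumes "\<mu> > -1/2"
  shows "dunkl_gamma \<mu> (Suc n) = (real n + 1 + (if even n then 2 * \<mu> else 0)) * dunkl_gamma \<mu> n"
proof (cases "even n")
  case True
  then obtain m where n: "n = 2 * m" by auto
  have "Gamma (real m + \<mu> + 3/2) = (real m + \<mu> + 1/2) * Gamma (real m + \<mu> + 1/2)"
    using Gamma_plus1[of "real m + \<mu> + 1/2"] assms
    by (auto simp: nonpos_Ints_def algebra_simps)
  then show ?thesis using n by (simp add: dunkl_gamma_def algebra_simps)
next
  case False
  then obtain m where n: "n = 2 * m + 1" by (elim oddE)
  then show ?thesis by (simp add: dunkl_gamma_def algebra_simps)
qed

lemma dunkl_gamma_pos:
  assumes "\<mu> > -1/2"
  shows "dunkl_gamma \<mu> n > 0"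
proof (induction n)
  case 0
  then show ?case using assms by (simp add: dunkl_gamma_0)
next
  case (Suc n)
  then show ?case using assms by (auto simp: dunkl_gamma_Suc)
qed

lemma dunkl_gamma_Suc_ge:
  assumes "\<mu> > -1/2"
  shows "real n * dunkl_gamma \<mu> n \<le> dunkl_gamma \<mu> (Suc n)"
  using assms dunkl_gamma_pos[OF assms, of n] by (subst dunkl_gamma_Suc) auto

lemma summable_dunkl_exp:
  assumes "\<mu> > -1/2"
  shows "summable (\<lambda>m. norm (z ^ m / complex_of_real (dunkl_gamma \<mu> m)))"
proof (rule summable_ratio_test)
  define N where "N = nat \<lceil>2 * cmod z\<rceil> + 1"
  fix n assume "n \<ge> N"
  then have n: "2 * cmod z \<le> n" "n > 0" unfolding N_def by linarith+
  have g: "dunkl_gamma \<mu> n > 0" "dunkl_gamma \<mu> (Suc n) > 0"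
    using dunkl_gamma_pos[OF assms] by auto
  have "2 * cmod z * dunkl_gamma \<mu> n \<le> real n * dunkl_gamma \<mu> n"
    using n g by (intro mult_right_mono) auto
  also have "\<dots> \<le> dunkl_gamma \<mu> (Suc n)" by (rule dunkl_gamma_Suc_ge[OF assms])
  finally have "cmod z / dunkl_gamma \<mu> (Suc n) \<le> 1/2 / dunkl_gamma \<mu> n"
    using g by (simp add: field_simps)
  then have "cmod z ^ n * (cmod z / dunkl_gamma \<mu> (Suc n)) \<le> cmod z ^ n * (1/2 / dunkl_gamma \<mu> n)"
    by (intro mult_left_mono) auto
  then show "norm (norm (z ^ Suc n / complex_of_real (dunkl_gamma \<mu> (Suc n))))
      \<le> 1/2 * norm (norm (z ^ n / complex_of_real (dunkl_gamma \<mu> n)))"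
    using g by (simp add: norm_divide norm_mult norm_power algebra_simps)
qed simp

text \<open>The real and imaginary part of \<open>e\<^sub>\<mu>\<close> on the imaginary axis, that is, its even and
  \<open>1/i\<close> times its odd part there; for \<open>\<mu> = 0\<close> they are cosine and sine. Up to constants and
  powers of \<open>y\<close> they are the Bessel functions of order \<open>\<mu> - 1/2\<close> and \<open>\<mu> + 1/2\<close>.\<close>

definition dunkl_cos :: "real \<Rightarrow> real \<Rightarrow> real" where
  "dunkl_cos \<mu> y = Re (dunkl_exp \<mu> (\<i> * y))"

definition dunkl_sin :: "real \<Rightarrow> real \<Rightarrow> real" where
  "dunkl_sin \<mu> y = Im (dunkl_exp \<mu> (\<i> * y))"

text \<open>Taylor coefficients at \<open>0\<close> of the two parts. The factors \<open>Re (\<i> ^ m)\<close> and \<open>Im (\<i> ^ m)\<close> select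
  the even and the odd indices and carry the alternating sign.\<close>

definition dunkl_cos_coeff :: "real \<Rightarrow> nat \<Rightarrow> real" where
  "dunkl_cos_coeff \<mu> m = Re (\<i> ^ m) / dunkl_gamma \<mu> m"

definition dunkl_sin_coeff :: "real \<Rightarrow> nat \<Rightarrow> real" where
  "dunkl_sin_coeff \<mu> m = Im (\<i> ^ m) / dunkl_gamma \<mu> m"

lemma dunkl_cos_sums:
  assumes "\<mu> > -1/2"
  shows "(\<lambda>m. dunkl_cos_coeff \<mu> m * y ^ m) sums dunkl_cos \<mu> y"
proof -
  have "(\<lambda>m. (\<i> * y) ^ m / complex_of_real (dunkl_gamma \<mu> m)) sums dunkl_exp \<mu> (\<i> * y)"
    unfolding dunkl_exp_def
    by (intro summable_sums summable_norm_cancel[OF summable_dunkl_exp[OF assms]])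
  then have "(\<lambda>m. Re ((\<i> * y) ^ m / complex_of_real (dunkl_gamma \<mu> m))) sums dunkl_cos \<mu> y"
    unfolding dunkl_cos_def by (rule sums_Re)
  then show ?thesis
    by (simp add: dunkl_cos_coeff_def power_mult_distrib Re_divide_of_real flip: of_real_power)
qed

lemma dunkl_sin_sums:
  assumes "\<mu> > -1/2"
  shows "(\<lambda>m. dunkl_sin_coeff \<mu> m * y ^ m) sums dunkl_sin \<mu> y"
proof -
  have "(\<lambda>m. (\<i> * y) ^ m / complex_of_real (dunkl_gamma \<mu> m)) sums dunkl_exp \<mu> (\<i> * y)"
    unfolding dunkl_exp_def
    by (intro summable_sums summable_norm_cancel[OF summable_dunkl_exp[OF assms]])
  then have "(\<lambda>m. Im ((\<i> * y) ^ m / complex_of_real (dunkl_gamma \<mu> m))) sums dunkl_sin \<mu> y"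
    unfolding dunkl_sin_def by (rule sums_Im)
  then show ?thesis
    by (simp add: dunkl_sin_coeff_def power_mult_distrib Im_divide_of_real flip: of_real_power)
qed

lemma i_power_parts:
  "even m \<Longrightarrow> Re (\<i> ^ m) = (-1) ^ (m div 2)" "odd m \<Longrightarrow> Re (\<i> ^ m) = 0"
  "odd m \<Longrightarrow> Im (\<i> ^ m) = (-1) ^ (m div 2)" "even m \<Longrightarrow> Im (\<i> ^ m) = 0"
proof -
  have e: "\<i> ^ (2 * k) = complex_of_real ((-1) ^ k)" for k by (simp add: power_mult)
  show "even m \<Longrightarrow> Re (\<i> ^ m) = (-1) ^ (m div 2)" "even m \<Longrightarrow> Im (\<i> ^ m) = 0"
    using e[of "m div 2"] by auto
  show "odd m \<Longrightarrow> Re (\<i> ^ m) = 0" "odd m \<Longrightarrow> Im (\<i> ^ m) = (-1) ^ (m div 2)"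
    using e[of "m div 2"] by (auto elim!: oddE)
qed

lemma dunkl_cos_minus: "\<mu> > -1/2 \<Longrightarrow> dunkl_cos \<mu> (-y) = dunkl_cos \<mu> y"
proof -
  assume \<mu>: "\<mu> > -1/2"
  have "(\<lambda>m. dunkl_cos_coeff \<mu> m * (-y) ^ m) = (\<lambda>m. dunkl_cos_coeff \<mu> m * y ^ m)"
    by (rule ext, rename_tac m, case_tac "even m") (auto simp: dunkl_cos_coeff_def i_power_parts)
  then show ?thesis using dunkl_cos_sums[OF \<mu>] by (metis sums_unique2)
qed

lemma dunkl_sin_minus: "\<mu> > -1/2 \<Longrightarrow> dunkl_sin \<mu> (-y) = - dunkl_sin \<mu> y"
proof -
  assume \<mu>: "\<mu> > -1/2"
  have "dunkl_sin_coeff \<mu> m * (-y) ^ m = - (dunkl_sin_coeff \<mu> m * y ^ m)" for m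
    by (cases "even m") (auto simp: dunkl_sin_coeff_def i_power_parts)
  then have "(\<lambda>m. dunkl_sin_coeff \<mu> m * (-y) ^ m) sums (- dunkl_sin \<mu> y)"
    using sums_minus[OF dunkl_sin_sums[OF \<mu>, of y]] by simp
  then show ?thesis using dunkl_sin_sums[OF \<mu>] by (metis sums_unique2)
qed

lemma has_field_derivative_dunkl_cos:
  assumes "\<mu> > -1/2"
  shows "(dunkl_cos \<mu> has_field_derivative - dunkl_sin \<mu> y) (at y)"
proof -
  have d: "diffs (dunkl_cos_coeff \<mu>) n = - dunkl_sin_coeff \<mu> n" for n
    using dunkl_gamma_pos[OF assms, of n]
    by (cases "even n") (simp_all add: diffs_def dunkl_cos_coeff_def dunkl_sin_coeff_def
        dunkl_gamma_Suc[OF assms] i_power_parts add.commute[of 1])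
  have "(\<lambda>y. \<Sum>m. dunkl_cos_coeff \<mu> m * y ^ m) = dunkl_cos \<mu>"
    using dunkl_cos_sums[OF assms] by (auto simp: sums_iff)
  moreover have "(\<Sum>m. diffs (dunkl_cos_coeff \<mu>) m * y ^ m) = - dunkl_sin \<mu> y"
    using sums_minus[OF dunkl_sin_sums[OF assms, of y]] by (simp add: d sums_iff)
  ultimately show ?thesis
    using termdiffs_strong_converges_everywhere[of "dunkl_cos_coeff \<mu>" y]
      dunkl_cos_sums[OF assms] by (auto simp: sums_iff)
qed

text \<open>Together with the preceding lemma this is the first-order system \<open>A' = -B\<close>,
  \<open>B' + 2 \<mu> B / y = A\<close> for the even part \<open>A\<close> and the odd part \<open>B\<close>, i.e. the eigenvalue equation
  \<open>T f = i f\<close>, at \<open>f = A + i B\<close>, of the Dunkl operator \<open>(T f) y = f' y + \<mu> / y * (f y - f (-y))\<close>.\<close>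

lemma has_field_derivative_dunkl_sin:
  assumes "\<mu> > -1/2" "y \<noteq> 0"
  shows "(dunkl_sin \<mu> has_field_derivative dunkl_cos \<mu> y - 2 * \<mu> * dunkl_sin \<mu> y / y) (at y)"
proof -
  let ?b = "dunkl_sin_coeff \<mu>"
  define D where "D = (\<Sum>m. diffs ?b m * y ^ m)"
  have eq: "(\<lambda>y. \<Sum>m. ?b m * y ^ m) = dunkl_sin \<mu>"
    using dunkl_sin_sums[OF assms(1)] by (auto simp: sums_iff)
  have sm: "summable (\<lambda>m. ?b m * y ^ m)" for y using dunkl_sin_sums[OF assms(1)] by (auto simp: sums_iff)
  have der: "(dunkl_sin \<mu> has_field_derivative D) (at y)"
    using termdiffs_strong_converges_everywhere[of ?b y, OF sm] by (simp add: eq D_def)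
  have "(\<lambda>m. diffs ?b m * y ^ m) sums D"
    using termdiff_converges_all[of ?b y, OF sm] by (simp add: D_def summable_sums)
  then have 1: "(\<lambda>m. y * (diffs ?b m * y ^ m)) sums (y * D)" by (rule sums_mult)
  \<comment> \<open>Compare the coefficients of \<open>y B' + 2 \<mu> B\<close> and \<open>y A\<close>; the series of \<open>B\<close> has no constant term.\<close>
  have b0: "?b 0 = 0" by (simp add: dunkl_sin_coeff_def)
  have 2: "(\<lambda>m. ?b (Suc m) * y ^ Suc m) sums dunkl_sin \<mu> y"
    using dunkl_sin_sums[OF assms(1), of y] by (subst sums_Suc_iff) (simp add: b0)
  have 3: "(\<lambda>m. y * (diffs ?b m * y ^ m) + 2 * \<mu> * (?b (Suc m) * y ^ Suc m)) sums
     (y * D + 2 * \<mu> * dunkl_sin \<mu> y)"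
    by (intro sums_add 1 sums_mult 2)
  have r: "(real m + 1 + 2 * \<mu>) * ?b (Suc m) = dunkl_cos_coeff \<mu> m" for m
    using dunkl_gamma_pos[OF assms(1), of m] assms(1)
    by (cases "even m") (simp_all add: dunkl_cos_coeff_def dunkl_sin_coeff_def
        dunkl_gamma_Suc[OF assms(1)] i_power_parts)
  have "y * (diffs ?b m * y ^ m) + 2 * \<mu> * (?b (Suc m) * y ^ Suc m)
     = y * (((real m + 1 + 2 * \<mu>) * ?b (Suc m)) * y ^ m)" for m
    by (simp add: diffs_def algebra_simps)
  with 3 have "(\<lambda>m. y * (dunkl_cos_coeff \<mu> m * y ^ m)) sums (y * D + 2 * \<mu> * dunkl_sin \<mu> y)"
    by (simp add: r)
  moreover have "(\<lambda>m. y * (dunkl_cos_coeff \<mu> m * y ^ m)) sums (y * dunkl_cos \<mu> y)"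
    by (intro sums_mult dunkl_cos_sums assms)
  ultimately have "y * D + 2 * \<mu> * dunkl_sin \<mu> y = y * dunkl_cos \<mu> y" by (rule sums_unique2)
  then have "D = dunkl_cos \<mu> y - 2 * \<mu> * dunkl_sin \<mu> y / y" using assms(2) by (simp add: field_simps)
  then show ?thesis using der by simp
qed

lemma continuous_dunkl_cos: "\<mu> > -1/2 \<Longrightarrow> continuous_on UNIV (dunkl_cos \<mu>)"
  using has_field_derivative_dunkl_cos DERIV_isCont by (fastforce simp: continuous_on_eq_continuous_at)

lemma continuous_dunkl_sin:
  assumes "\<mu> > -1/2" shows "continuous_on UNIV (dunkl_sin \<mu>)"
proof -
  have sm: "summable (\<lambda>m. dunkl_sin_coeff \<mu> m * y ^ m)" for y
    using dunkl_sin_sums[OF assms(1)] by (auto simp: sums_iff)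
  have "(\<lambda>y. \<Sum>m. dunkl_sin_coeff \<mu> m * y ^ m) = dunkl_sin \<mu>"
    using dunkl_sin_sums[OF assms(1)] by (auto simp: sums_iff)
  then show ?thesis
    using termdiffs_strong_converges_everywhere[of "dunkl_sin_coeff \<mu>", OF sm] DERIV_isCont
    by (fastforce simp: continuous_on_eq_continuous_at)
qed

section \<open>Growth on the imaginary axis\<close>

text \<open>For \<open>\<mu> \<ge> 0\<close> the energy \<open>A\<^sup>2 + B\<^sup>2\<close> has derivative \<open>- 4 \<mu> B\<^sup>2 / y\<close>, so it decreases on
  \<open>[0, \<infinity>)\<close>.\<close>

lemma dunkl_cos_sin_bound_nonneg:
  assumes "\<mu> \<ge> 0" "y \<ge> 0"
  shows "(dunkl_cos \<mu> y)\<^sup>2 + (dunkl_sin \<mu> y)\<^sup>2 \<le> (dunkl_cos \<mu> 0)\<^sup>2 + (dunkl_sin \<mu> 0)\<^sup>2"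
proof (rule DERIV_nonpos_imp_decreasing_open[OF assms(2)])
  have \<mu>: "\<mu> > -1/2" using assms by simp
  show "continuous_on {0..y} (\<lambda>y. (dunkl_cos \<mu> y)\<^sup>2 + (dunkl_sin \<mu> y)\<^sup>2)"
    by (intro continuous_intros continuous_on_subset[OF continuous_dunkl_cos[OF \<mu>]]
        continuous_on_subset[OF continuous_dunkl_sin[OF \<mu>]]) auto
  fix x assume x: "0 < x" "x < y"
  have "((\<lambda>y. (dunkl_cos \<mu> y)\<^sup>2 + (dunkl_sin \<mu> y)\<^sup>2) has_field_derivative
      2 * dunkl_cos \<mu> x * (- dunkl_sin \<mu> x) +
      2 * dunkl_sin \<mu> x * (dunkl_cos \<mu> x - 2 * \<mu> * dunkl_sin \<mu> x / x)) (at x)"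
    using x by (auto intro!: derivative_eq_intros has_field_derivative_dunkl_cos[OF \<mu>]
        has_field_derivative_dunkl_sin[OF \<mu>])
  also have "2 * dunkl_cos \<mu> x * (- dunkl_sin \<mu> x) +
      2 * dunkl_sin \<mu> x * (dunkl_cos \<mu> x - 2 * \<mu> * dunkl_sin \<mu> x / x)
      = - (4 * \<mu> * (dunkl_sin \<mu> x)\<^sup>2 / x)"
    by (simp add: algebra_simps power2_eq_square)
  finally show "\<exists>D. ((\<lambda>y. (dunkl_cos \<mu> y)\<^sup>2 + (dunkl_sin \<mu> y)\<^sup>2) has_field_derivative D) (at x) \<and> D \<le> 0"
    using x assms(1) by (intro exI[of _ "- (4 * \<mu> * (dunkl_sin \<mu> x)\<^sup>2 / x)"]) auto
qed

lemma mult_le_sum_squares: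
  fixes a b k :: real
  assumes "\<bar>k\<bar> \<le> 2"
  shows "k * (a * b) \<le> a\<^sup>2 + b\<^sup>2"
proof -
  have "k * (a * b) \<le> \<bar>k\<bar> * \<bar>a * b\<bar>" by (metis abs_ge_self abs_mult)
  also have "\<dots> \<le> 2 * \<bar>a * b\<bar>" using assms by (intro mult_right_mono) auto
  also have "\<dots> \<le> a\<^sup>2 + b\<^sup>2"
    using zero_le_power2[of "\<bar>a\<bar> - \<bar>b\<bar>"] by (simp add: power2_eq_square algebra_simps abs_mult)
  finally show ?thesis .
qed

text \<open>For \<open>\<mu> < 0\<close> the plain energy only yields growth of order \<open>y powr (- 2 * \<mu>)\<close> for \<open>e\<^sub>\<mu>\<close> itself,
  which is twice the admissible exponent. The loss comes from the estimate \<open>B\<^sup>2 \<le> A\<^sup>2 + B\<^sup>2\<close>, although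
  on average \<open>B\<^sup>2\<close> is only half of the energy. The corrected energy
  \<open>y powr (2 * \<mu>) * (A\<^sup>2 + B\<^sup>2 - 2 * \<mu> * A * B / y)\<close> accounts for this: its derivative is
  \<open>2 * \<mu> * y powr (2 * \<mu> - 2) * A * B\<close>, an integrable relative error, which the factor \<open>exp (1 / y)\<close>
  absorbs.\<close>

lemma dunkl_cos_sin_bound_neg:
  assumes "\<mu> > -1/2" "\<mu> < 0"
  shows "\<exists>C. \<forall>y\<ge>1. (dunkl_cos \<mu> y)\<^sup>2 + (dunkl_sin \<mu> y)\<^sup>2 \<le> C * y powr (- 2 * \<mu>)"
proof -
  let ?A = "dunkl_cos \<mu>" and ?B = "dunkl_sin \<mu>"
  define S where "S x = (?A x)\<^sup>2 + (?B x)\<^sup>2 - 2 * \<mu> * (?A x * ?B x) / x" for x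
  define H where "H x = x powr (2 * \<mu>) * S x * exp (1 / x)" for x
  have S: "(?A x)\<^sup>2 + (?B x)\<^sup>2 \<le> 2 * S x" if "x \<ge> 1" for x
  proof -
    have "\<bar>4 * \<mu> / x\<bar> \<le> 2" using that assms by (simp add: field_simps)
    from mult_le_sum_squares[OF this, of "?A x" "?B x"] show ?thesis by (simp add: S_def)
  qed
  have dec: "H 1 \<ge> H y" if "y \<ge> 1" for y
  proof (rule DERIV_nonpos_imp_nonincreasing[OF that])
    fix x :: real assume x: "1 \<le> x" "x \<le> y"
    let ?p = "x powr (2 * \<mu>)" and ?e = "exp (1 / x)"
    have dp: "((\<lambda>x. x powr (2 * \<mu>)) has_field_derivative 2 * \<mu> * ?p / x) (at x)"
      using x by (auto intro!: derivative_eq_intros simp: powr_diff)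
    have de: "((\<lambda>x. exp (1 / x)) has_field_derivative - ?e / x\<^sup>2) (at x)"
      using x by (auto intro!: derivative_eq_intros simp: power2_eq_square field_simps)
    define A B where AB: "A = ?A x" "B = ?B x"
    define S' where "S' = 2 * A * (- B) + 2 * B * (A - 2 * \<mu> * B / x)
        - ((2 * \<mu> * (- B * B + A * (A - 2 * \<mu> * B / x))) * x - 2 * \<mu> * (A * B)) / (x * x)"
    have dS: "(S has_field_derivative S') (at x)"
      unfolding S_def S'_def AB using x
      by (auto intro!: derivative_eq_intros has_field_derivative_dunkl_cos
        has_field_derivative_dunkl_sin assms simp: algebra_simps)
    have "(H has_field_derivative (2 * \<mu> * ?p / x * S x + ?p * S') * ?e + ?p * S x * (- ?e / x\<^sup>2)) (at x)"
      unfolding H_def by (rule DERIV_cong[OF DERIV_mult[OF DERIV_mult[OF dp dS] de]]) (simp add: mult_ac)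
    also have "(2 * \<mu> * ?p / x * S x + ?p * S') * ?e + ?p * S x * (- ?e / x\<^sup>2)
        = ?p * ?e / x\<^sup>2 * ((2 * \<mu> * x * S x + x\<^sup>2 * S') - S x)"
      using x by (simp add: field_simps power2_eq_square)
    also have "2 * \<mu> * x * S x + x\<^sup>2 * S' = 2 * \<mu> * (A * B)"
      using x by (simp add: S_def S'_def AB[symmetric] field_simps power2_eq_square)
    finally have der: "(H has_field_derivative ?p * ?e / x\<^sup>2 * (2 * \<mu> * (A * B) - S x)) (at x)" .
    have "\<bar>\<mu> * (1 + 1 / x)\<bar> \<le> 1/2 * 2"
      unfolding abs_mult using x assms by (intro mult_mono) (auto simp: field_simps)
    then have "\<bar>2 * \<mu> * (1 + 1 / x)\<bar> \<le> 2" by simp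
    from mult_le_sum_squares[OF this, of A B] have "2 * \<mu> * (A * B) - S x \<le> 0"
      by (simp add: S_def AB algebra_simps)
    then have "?p * ?e / x\<^sup>2 * (2 * \<mu> * (A * B) - S x) \<le> 0"
      by (intro mult_nonneg_nonpos) auto
    with der show "\<exists>D. (H has_field_derivative D) (at x) \<and> D \<le> 0" by blast
  qed
  have "(?A y)\<^sup>2 + (?B y)\<^sup>2 \<le> 2 * H 1 * y powr (- 2 * \<mu>)" if y: "y \<ge> 1" for y
  proof -
    let ?p = "y powr (2 * \<mu>)"
    have S0: "S y \<ge> 0" using S[OF y] by (smt (verit) zero_le_power2)
    have "?p * ((?A y)\<^sup>2 + (?B y)\<^sup>2) \<le> ?p * (2 * S y)" using S[OF y] by (intro mult_left_mono) auto
    also have "\<dots> \<le> 2 * H y"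
      using y S0 mult_left_mono[of 1 "exp (1/y)" "?p * S y"] by (simp add: H_def)
    also have "\<dots> \<le> 2 * H 1" using dec[OF y] by simp
    finally have "?p * ((?A y)\<^sup>2 + (?B y)\<^sup>2) \<le> 2 * H 1" .
    then show ?thesis using y by (simp add: powr_minus field_simps)
  qed
  then show ?thesis by blast
qed

text \<open>The growth bound that makes \<open>e\<^sub>\<mu>(ixt)\<close> integrable: boundedness for \<open>\<mu> \<ge> 0\<close>, order
  \<open>-\<mu>\<close> for \<open>\<mu> < 0\<close>. Recall \<open>0 powr 0 = 0\<close>, so for \<open>\<mu> \<ge> 0\<close> the summand \<open>1\<close> is needed at \<open>y = 0\<close>.\<close>

lemma dunkl_cos_sin_bound:
  assumes "\<mu> > -1/2"
  shows "\<exists>C. \<forall>y. \<bar>dunkl_cos \<mu> y\<bar> \<le> C * (1 + \<bar>y\<bar> powr max 0 (-\<mu>))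
                 \<and> \<bar>dunkl_sin \<mu> y\<bar> \<le> C * (1 + \<bar>y\<bar> powr max 0 (-\<mu>))"
proof -
  define Q where "Q y = (dunkl_cos \<mu> y)\<^sup>2 + (dunkl_sin \<mu> y)\<^sup>2" for y
  define k where "k = max 0 (-\<mu>)"
  have "\<exists>C. \<forall>y\<ge>0. Q y \<le> C * (1 + y powr k)\<^sup>2"
  proof (cases "\<mu> \<ge> 0")
    case True
    have "Q y \<le> Q 0 * (1 + y powr k)\<^sup>2" if "y \<ge> 0" for y
    proof -
      have "Q y \<le> Q 0" using dunkl_cos_sin_bound_nonneg[OF True that] by (simp add: Q_def)
      also have "\<dots> \<le> Q 0 * (1 + y powr k)\<^sup>2"
        using mult_left_mono[of 1 "(1 + y powr k)\<^sup>2" "Q 0"] by (simp add: Q_def)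
      finally show ?thesis .
    qed
    then show ?thesis by blast
  next
    case False
    then obtain C where C: "\<And>y. y \<ge> 1 \<Longrightarrow> Q y \<le> C * y powr (- 2 * \<mu>)"
      using dunkl_cos_sin_bound_neg[OF assms] by (auto simp: Q_def)
    have "continuous_on {0..1} Q" unfolding Q_def
      by (intro continuous_intros continuous_on_subset[OF continuous_dunkl_cos[OF assms]]
        continuous_on_subset[OF continuous_dunkl_sin[OF assms]]) auto
    then have "compact (Q ` {0..1})" by (intro compact_continuous_image) auto
    then obtain D where D: "\<And>y. y \<in> {0..1} \<Longrightarrow> Q y \<le> D"
      using compact_imp_bounded bounded_real by (metis abs_le_D1 imageI)
    have "Q y \<le> max \<bar>C\<bar> \<bar>D\<bar> * (1 + y powr k)\<^sup>2" if y: "y \<ge> 0" for y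
    proof (cases "y \<ge> 1")
      case True
      have "Q y \<le> C * y powr (- 2 * \<mu>)" by (rule C[OF True])
      also have "\<dots> \<le> max \<bar>C\<bar> \<bar>D\<bar> * y powr (- 2 * \<mu>)" by (intro mult_right_mono) auto
      also have "y powr (- 2 * \<mu>) = (y powr k)\<^sup>2"
        using False True by (simp add: k_def powr_power)
      also have "max \<bar>C\<bar> \<bar>D\<bar> * (y powr k)\<^sup>2 \<le> max \<bar>C\<bar> \<bar>D\<bar> * (1 + y powr k)\<^sup>2"
        by (intro mult_left_mono power_mono) auto
      finally show ?thesis .
    next
      case False
      then have "Q y \<le> D" using D y by auto
      also have "\<dots> \<le> max \<bar>C\<bar> \<bar>D\<bar> * 1" by auto
      also have "\<dots> \<le> max \<bar>C\<bar> \<bar>D\<bar> * (1 + y powr k)\<^sup>2"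
        by (intro mult_left_mono) auto
      finally show ?thesis .
    qed
    then show ?thesis by blast
  qed
  then obtain C where C: "\<And>y. y \<ge> 0 \<Longrightarrow> Q y \<le> C * (1 + y powr k)\<^sup>2" by blast
  have QQ: "Q y = Q \<bar>y\<bar>" for y
    by (cases "y \<ge> 0") (auto simp: Q_def dunkl_cos_minus[OF assms] dunkl_sin_minus[OF assms])
  have "sqrt (Q y) \<le> sqrt C * (1 + \<bar>y\<bar> powr k)" for y
    using real_sqrt_le_mono[OF C[of "\<bar>y\<bar>"]] by (simp add: real_sqrt_mult flip: QQ)
  moreover have "\<bar>dunkl_cos \<mu> y\<bar> \<le> sqrt (Q y)" "\<bar>dunkl_sin \<mu> y\<bar> \<le> sqrt (Q y)" for y
    by (simp_all add: Q_def)
  ultimately show ?thesis unfolding k_def[symmetric] by (meson order.trans)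
qed

section \<open>Gaussian averages of the kernels\<close>

text \<open>The density of the Gamma distribution with parameter \<open>s\<close>, without its normalising
  factor and extended by zero to the half-line \<open>u \<le> 0\<close>.\<close>

definition gamma_weight :: "real \<Rightarrow> real \<Rightarrow> real" where
  "gamma_weight s u = (if u > 0 then u powr (s - 1) * exp (- u) else 0)"

lemma gamma_weight_nonneg: "gamma_weight s u \<ge> 0"
  by (simp add: gamma_weight_def)

lemma gamma_weight_measurable [measurable]: "gamma_weight s \<in> borel_measurable borel"
  unfolding gamma_weight_def by measurable

lemma gamma_weight_powr: "gamma_weight s u * u powr r = gamma_weight (s + r) u"
  by (simp add: gamma_weight_def powr_add[symmetric] algebra_simps)

lemma has_bochner_integral_gamma_weight:
  assumes "s > 0"
  shows "has_bochner_integral lborel (gamma_weight s) (Gamma s)"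
proof (rule has_bochner_integral_nn_integral)
  have "(\<integral>\<^sup>+u. ennreal (gamma_weight s u) \<partial>lborel)
      = (\<integral>\<^sup>+u. ennreal (indicator {0..} u * u powr (s - 1) / exp u) \<partial>lborel)"
    by (intro nn_integral_cong) (auto simp: gamma_weight_def indicator_def exp_minus field_simps)
  then show "(\<integral>\<^sup>+u. ennreal (gamma_weight s u) \<partial>lborel) = ennreal (Gamma s)"
    using Gamma_conv_nn_integral_real[OF assms] by simp
qed (use assms Gamma_real_pos[of s] in \<open>auto simp: gamma_weight_nonneg less_imp_le\<close>)

lemma power_series_gamma_integral:
  assumes s: "s > 0"
    and sm: "summable (\<lambda>k. \<bar>c k\<bar> * Gamma (s + real k))"
    and g: "\<And>u. u > 0 \<Longrightarrow> (\<lambda>k. c k * u ^ k) sums g u"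
  shows "(\<lambda>k. c k * Gamma (s + real k)) sums (\<integral>u. g u * gamma_weight s u \<partial>lborel)"
proof -
  have i: "has_bochner_integral lborel (\<lambda>u. C * gamma_weight (s + real k) u) (C * Gamma (s + real k))"
    for C k
    using s by (intro has_bochner_integral_mult_right has_bochner_integral_gamma_weight) auto
  have w: "gamma_weight (s + real k) u = u ^ k * gamma_weight s u" for k u
    using gamma_weight_powr[of s u "real k"]
    by (cases "u > 0") (simp_all add: powr_realpow mult.commute gamma_weight_def)
  have abs_sm: "summable (\<lambda>k. norm (c k * gamma_weight (s + real k) u))" for u
  proof (cases "u > 0")
    case True
    have "summable (\<lambda>k. norm (c k * u ^ k))"
      using True by (intro powser_insidea[of c "2 * u"] sums_summable[OF g]) auto
    from summable_mult2[OF this, of "\<bar>gamma_weight s u\<bar>"] show ?thesis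
      by (simp add: w abs_mult mult_ac)
  qed (simp add: gamma_weight_def)
  have "(\<lambda>k. (\<integral>u. c k * gamma_weight (s + real k) u \<partial>lborel))
      sums (\<integral>u. (\<Sum>k. c k * gamma_weight (s + real k) u) \<partial>lborel)"
  proof (rule sums_integral)
    show "integrable lborel (\<lambda>u. c k * gamma_weight (s + real k) u)" for k
      using i has_bochner_integral_iff by blast
    show "AE u in lborel. summable (\<lambda>k. norm (c k * gamma_weight (s + real k) u))"
      using abs_sm by simp
    have "(\<integral>u. norm (c k * gamma_weight (s + real k) u) \<partial>lborel) = \<bar>c k\<bar> * Gamma (s + real k)" for k
      using i[of "\<bar>c k\<bar>" k] by (simp add: abs_mult gamma_weight_nonneg has_bochner_integral_iff)
    then show "summable (\<lambda>k. \<integral>u. norm (c k * gamma_weight (s + real k) u) \<partial>lborel)"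
      using sm by simp
  qed
  moreover have "(\<integral>u. c k * gamma_weight (s + real k) u \<partial>lborel) = c k * Gamma (s + real k)" for k
    using i has_bochner_integral_iff by blast
  moreover have "(\<Sum>k. c k * gamma_weight (s + real k) u) = g u * gamma_weight s u" for u
  proof (cases "u > 0")
    case True
    from sums_mult2[OF g[OF True], of "gamma_weight s u"] show ?thesis
      by (simp add: w sums_iff mult_ac)
  qed (simp add: gamma_weight_def)
  ultimately show ?thesis by (simp only:)
qed

lemma dunkl_cos_even_sums:
  assumes "\<mu> > -1/2"
  shows "(\<lambda>k. (-1) ^ k / dunkl_gamma \<mu> (2 * k) * y ^ (2 * k)) sums dunkl_cos \<mu> y"
proof -
  have "(\<lambda>k. dunkl_cos_coeff \<mu> (2 * k) * y ^ (2 * k)) sums dunkl_cos \<mu> y"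
    using dunkl_cos_sums[OF assms, of y]
    by (subst sums_mono_reindex[where g = "\<lambda>k. 2 * k" and f = "\<lambda>m. dunkl_cos_coeff \<mu> m * y ^ m"])
       (auto simp: strict_mono_def dunkl_cos_coeff_def image_iff intro!: i_power_parts elim!: evenE)
  then show ?thesis by (simp add: dunkl_cos_coeff_def i_power_parts)
qed

lemma dunkl_sin_odd_sums:
  assumes "\<mu> > -1/2"
  shows "(\<lambda>k. (-1) ^ k / dunkl_gamma \<mu> (2 * k + 1) * y ^ (2 * k + 1)) sums dunkl_sin \<mu> y"
proof -
  have z: "dunkl_sin_coeff \<mu> m * y ^ m = 0" if "m \<notin> range (\<lambda>k. 2 * k + 1)" for m
  proof -
    have "even m" using that by (metis oddE rangeI)
    then show ?thesis by (simp add: dunkl_sin_coeff_def i_power_parts)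
  qed
  have "(\<lambda>k. dunkl_sin_coeff \<mu> (2 * k + 1) * y ^ (2 * k + 1)) sums dunkl_sin \<mu> y"
    using dunkl_sin_sums[OF assms, of y] z
    by (subst sums_mono_reindex[where g = "\<lambda>k. 2 * k + 1" and f = "\<lambda>m. dunkl_sin_coeff \<mu> m * y ^ m"])
       (auto simp: strict_mono_def)
  then show ?thesis by (simp add: dunkl_sin_coeff_def i_power_parts del: power_Suc)
qed

text \<open>With \<open>x = sqrt u\<close> this is the Hankel transform of a Gaussian, which is again a Gaussian: the
  Gamma factors of \<open>\<gamma>\<^sub>\<mu>(2k)\<close> cancel against the Gamma integrals of the powers of \<open>u\<close>.\<close>

lemma dunkl_cos_gamma_integral:
  assumes "\<mu> > -1/2"
  shows "(\<integral>u. dunkl_cos \<mu> (z * sqrt u) * gamma_weight (\<mu> + 1/2) u \<partial>lborel)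
    = Gamma (\<mu> + 1/2) * exp (- (z\<^sup>2 / 4))"
proof -
  define c where "c k = (-1) ^ k / dunkl_gamma \<mu> (2 * k) * (z\<^sup>2) ^ k" for k
  have G: "Gamma (\<mu> + 1/2 + real k) > 0" for k using assms by (intro Gamma_real_pos) auto
  have cG: "c k * Gamma (\<mu> + 1/2 + real k) = Gamma (\<mu> + 1/2) * ((- (z\<^sup>2 / 4)) ^ k /\<^sub>R fact k)" for k
  proof -
    have "(2::real) ^ (2 * k) = 4 ^ k" by (simp add: power_mult)
    then show ?thesis using G[of k]
      by (simp add: c_def dunkl_gamma_def add_ac power_divide power_minus[of "z\<^sup>2 / 4"] field_simps)
  qed
  have e: "(\<lambda>k. Gamma (\<mu> + 1/2) * ((- (z\<^sup>2 / 4)) ^ k /\<^sub>R fact k)) sums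
      (Gamma (\<mu> + 1/2) * exp (- (z\<^sup>2 / 4)))"
    by (intro sums_mult exp_converges)
  have "(\<lambda>k. c k * Gamma (\<mu> + 1/2 + real k)) sums
      (\<integral>u. dunkl_cos \<mu> (z * sqrt u) * gamma_weight (\<mu> + 1/2) u \<partial>lborel)"
  proof (rule power_series_gamma_integral)
    have "\<bar>c k\<bar> * Gamma (\<mu> + 1/2 + real k)
        = \<bar>Gamma (\<mu> + 1/2)\<bar> * norm ((- (z\<^sup>2 / 4)) ^ k /\<^sub>R fact k)" for k
      using arg_cong[OF cG[of k], of abs] G[of k] by (simp add: abs_mult)
    then show "summable (\<lambda>k. \<bar>c k\<bar> * Gamma (\<mu> + 1/2 + real k))"
      by (simp only:) (intro summable_mult summable_norm_exp)
    fix u :: real assume u: "u > 0"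
    have "(z * sqrt u) ^ (2 * k) = (z\<^sup>2) ^ k * u ^ k" for k
      using u by (simp add: power_mult power_mult_distrib)
    then show "(\<lambda>k. c k * u ^ k) sums dunkl_cos \<mu> (z * sqrt u)"
      using dunkl_cos_even_sums[OF assms, of "z * sqrt u"] by (simp add: c_def mult.assoc)
  qed (use assms in auto)
  then show ?thesis unfolding cG using e by (rule sums_unique2)
qed

text \<open>The odd counterpart, whose transform is \<open>z\<close> times a Gaussian.\<close>

lemma dunkl_sin_gamma_integral:
  assumes "\<mu> > -1/2"
  shows "(\<integral>u. dunkl_sin \<mu> (z * sqrt u) * gamma_weight (\<mu> + 1) u \<partial>lborel)
    = Gamma (\<mu> + 1/2) * (z / 2 * exp (- (z\<^sup>2 / 4)))"
proof -
  define c where "c k = (-1) ^ k / dunkl_gamma \<mu> (2 * k + 1) * z * (z\<^sup>2) ^ k" for k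
  have G: "Gamma (\<mu> + 3/2 + real k) > 0" for k using assms by (intro Gamma_real_pos) auto
  have cG: "c k * Gamma (\<mu> + 3/2 + real k) = Gamma (\<mu> + 1/2) * (z / 2) * ((- (z\<^sup>2 / 4)) ^ k /\<^sub>R fact k)" for k
  proof -
    have "(2::real) ^ (2 * k) = 4 ^ k" by (simp add: power_mult)
    then show ?thesis using G[of k]
      by (simp add: c_def dunkl_gamma_def add_ac power_divide power_minus[of "z\<^sup>2 / 4"] field_simps)
  qed
  have e: "(\<lambda>k. Gamma (\<mu> + 1/2) * (z / 2) * ((- (z\<^sup>2 / 4)) ^ k /\<^sub>R fact k)) sums
      (Gamma (\<mu> + 1/2) * (z / 2) * exp (- (z\<^sup>2 / 4)))"
    by (intro sums_mult exp_converges)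
  \<comment> \<open>The series of the sine part runs over half-integer powers of \<open>u\<close>; dividing by \<open>sqrt u\<close> and
    raising the parameter of the weight by \<open>1/2\<close> makes them integer.\<close>
  have "(\<lambda>k. c k * Gamma (\<mu> + 3/2 + real k)) sums
      (\<integral>u. dunkl_sin \<mu> (z * sqrt u) / sqrt u * gamma_weight (\<mu> + 3/2) u \<partial>lborel)"
  proof (rule power_series_gamma_integral)
    have "\<bar>c k\<bar> * Gamma (\<mu> + 3/2 + real k)
        = \<bar>Gamma (\<mu> + 1/2) * (z / 2)\<bar> * norm ((- (z\<^sup>2 / 4)) ^ k /\<^sub>R fact k)" for k
      using arg_cong[OF cG[of k], of abs] G[of k] by (simp add: abs_mult)
    then show "summable (\<lambda>k. \<bar>c k\<bar> * Gamma (\<mu> + 3/2 + real k))"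
      by (simp only:) (intro summable_mult summable_norm_exp)
    fix u :: real assume u: "u > 0"
    have "(z * sqrt u) ^ (2 * k + 1) = z * sqrt u * ((z\<^sup>2) ^ k * u ^ k)" for k
      using u by (simp add: power_mult power_mult_distrib)
    then have "(-1) ^ k / dunkl_gamma \<mu> (2 * k + 1) * (z * sqrt u) ^ (2 * k + 1) / sqrt u = c k * u ^ k" for k
      using u by (simp add: c_def del: power_Suc)
    then show "(\<lambda>k. c k * u ^ k) sums (dunkl_sin \<mu> (z * sqrt u) / sqrt u)"
      using sums_divide[OF dunkl_sin_odd_sums[OF assms, of "z * sqrt u"], of "sqrt u"]
      by (simp only:)
  qed (use assms in auto)
  moreover have "dunkl_sin \<mu> (z * sqrt u) / sqrt u * gamma_weight (\<mu> + 3/2) u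
      = dunkl_sin \<mu> (z * sqrt u) * gamma_weight (\<mu> + 1) u" for u
    using gamma_weight_powr[of "\<mu> + 1" u "1/2"]
    by (cases "u > 0") (simp_all add: powr_half_sqrt field_simps gamma_weight_def)
  ultimately have "(\<lambda>k. c k * Gamma (\<mu> + 3/2 + real k)) sums
      (\<integral>u. dunkl_sin \<mu> (z * sqrt u) * gamma_weight (\<mu> + 1) u \<partial>lborel)"
    by simp
  then show ?thesis unfolding cG using sums_unique2[OF e] by (simp add: mult.assoc)
qed

section \<open>Measures determined by Gaussian moments\<close>

lemma moments_zero_continuous:
  fixes h u :: "'a \<Rightarrow> real"
  assumes h: "integrable N h" and u[measurable]: "u \<in> borel_measurable N"
    and u01: "\<And>x. u x \<in> {0..1}"
    and mom: "\<And>n. (\<integral>x. h x * u x ^ n \<partial>N) = 0"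
    and \<phi>: "continuous_on UNIV \<phi>"
  shows "(\<integral>x. h x * \<phi> (u x) \<partial>N) = 0"
proof -
  have [measurable]: "h \<in> borel_measurable N" using h by simp
  have [measurable]: "\<phi> \<in> borel_measurable borel" using \<phi> by (rule borel_measurable_continuous_onI)
  define I where "I = (\<integral>x. \<bar>h x\<bar> \<partial>N)"
  have bound: "\<bar>\<integral>x. h x * \<phi> (u x) \<partial>N\<bar> \<le> e * I" if e: "e > 0" for e
  proof -
    obtain p where p: "polynomial_function p" "\<forall>y\<in>{0..1}. norm (\<phi> y - p y) < e"
      using Stone_Weierstrass_polynomial_function[of "{0..1::real}" \<phi> e] e \<phi>
      by (auto intro: continuous_on_subset)
    then have "real_polynomial_function p" by (simp add: real_polynomial_function_eq)
    then obtain a n where pe: "p = (\<lambda>y. \<Sum>i\<le>n. a i * y ^ i)"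
      using real_polynomial_function_imp_sum by blast
    have int_pow: "integrable N (\<lambda>x. a i * (h x * u x ^ i))" for i
    proof (intro integrable_mult_right Bochner_Integration.integrable_bound[OF h] AE_I2)
      fix x
      have "\<bar>u x ^ i\<bar> \<le> 1" using u01[of x] by (simp add: power_abs power_le_one)
      then show "norm (h x * u x ^ i) \<le> norm (h x)" by (simp add: abs_mult mult_left_le)
    qed simp
    have hp: "h x * p (u x) = (\<Sum>i\<le>n. a i * (h x * u x ^ i))" for x
      by (simp add: pe sum_distrib_left mult_ac)
    have int_p: "integrable N (\<lambda>x. h x * p (u x))" unfolding hp by (intro Bochner_Integration.integrable_sum int_pow)
    have zero_p: "(\<integral>x. h x * p (u x) \<partial>N) = 0"
      unfolding hp using int_pow by (subst Bochner_Integration.integral_sum) (auto simp: mom)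
    have le: "\<bar>h x * (\<phi> (u x) - p (u x))\<bar> \<le> e * \<bar>h x\<bar>" for x
    proof -
      have "\<bar>\<phi> (u x) - p (u x)\<bar> \<le> e" using p(2) u01[of x] by (simp add: less_imp_le)
      from mult_left_mono[OF this, of "\<bar>h x\<bar>"] show ?thesis by (simp add: abs_mult mult.commute)
    qed
    have [measurable]: "p \<in> borel_measurable borel"
      unfolding pe by measurable
    have int_d: "integrable N (\<lambda>x. h x * (\<phi> (u x) - p (u x)))"
    proof (intro Bochner_Integration.integrable_bound[OF integrable_mult_right[OF integrable_abs[OF h], of e]] AE_I2)
      show "norm (h x * (\<phi> (u x) - p (u x))) \<le> norm (e * \<bar>h x\<bar>)" for x
        unfolding real_norm_def by (rule order_trans[OF le abs_ge_self])
    qed simp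
    have "(\<integral>x. h x * \<phi> (u x) \<partial>N) = (\<integral>x. h x * (\<phi> (u x) - p (u x)) + h x * p (u x) \<partial>N)"
      by (simp add: algebra_simps)
    also have "\<dots> = (\<integral>x. h x * (\<phi> (u x) - p (u x)) \<partial>N)"
      using int_d int_p zero_p by simp
    also have "\<bar>\<dots>\<bar> \<le> (\<integral>x. \<bar>h x * (\<phi> (u x) - p (u x))\<bar> \<partial>N)"
      using integral_norm_bound[of N "\<lambda>x. h x * (\<phi> (u x) - p (u x))"] by simp
    also have "\<dots> \<le> (\<integral>x. e * \<bar>h x\<bar> \<partial>N)"
      using int_d h le by (intro integral_mono) auto
    also have "\<dots> = e * I" by (simp add: I_def)
    finally show ?thesis .
  qed
  have "I \<ge> 0" by (simp add: I_def)
  have "\<bar>\<integral>x. h x * \<phi> (u x) \<partial>N\<bar> \<le> 0"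
  proof (rule field_le_epsilon)
    fix e :: real assume "e > 0"
    then have "\<bar>\<integral>x. h x * \<phi> (u x) \<partial>N\<bar> \<le> e / (I + 1) * I"
      using \<open>I \<ge> 0\<close> by (intro bound) simp
    also have "\<dots> \<le> e" using \<open>I \<ge> 0\<close> \<open>e > 0\<close> by (simp add: field_simps)
    finally show "\<bar>\<integral>x. h x * \<phi> (u x) \<partial>N\<bar> \<le> 0 + e" by simp
  qed
  then show ?thesis by simp
qed

lemma moments_zero_halfline:
  fixes h u :: "'a \<Rightarrow> real"
  assumes h: "integrable N h" and u[measurable]: "u \<in> borel_measurable N"
    and u01: "\<And>x. u x \<in> {0..1}"
    and mom: "\<And>n. (\<integral>x. h x * u x ^ n \<partial>N) = 0"
  shows "(\<integral>x. h x * indicator {c<..} (u x) \<partial>N) = 0"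
proof -
  have [measurable]: "h \<in> borel_measurable N" using h by simp
  define r where "r n y = min 1 (max 0 (real n * (y - c)))" for n y
  have "(\<lambda>n. \<integral>x. h x * r n (u x) \<partial>N) \<longlonglongrightarrow> (\<integral>x. h x * indicator {c<..} (u x) \<partial>N)"
  proof (rule integral_dominated_convergence[where w = "\<lambda>x. \<bar>h x\<bar>"])
    show "AE x in N. (\<lambda>n. h x * r n (u x)) \<longlonglongrightarrow> h x * indicator {c<..} (u x)"
    proof (intro AE_I2 tendsto_mult_left)
      fix x
      show "(\<lambda>n. r n (u x)) \<longlonglongrightarrow> indicator {c<..} (u x)"
      proof (cases "u x > c")
        case True
        obtain m where m: "real m * (u x - c) > 1"
          using reals_Archimedean3[of "u x - c"] True by auto
        have "r n (u x) = 1" if "n \<ge> m" for n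
        proof -
          have "1 < real m * (u x - c)" by fact
          also have "\<dots> \<le> real n * (u x - c)" using that True by (intro mult_right_mono) auto
          finally show ?thesis by (simp add: r_def)
        qed
        then show ?thesis using True
          by (intro tendsto_eventually eventually_sequentiallyI[of m]) simp
      next
        case False
        then have "r n (u x) = 0" for n by (simp add: r_def mult_nonneg_nonpos)
        then show ?thesis using False by simp
      qed
    qed
    show "AE x in N. norm (h x * r n (u x)) \<le> \<bar>h x\<bar>" for n
      by (intro AE_I2) (auto simp: r_def abs_mult intro!: mult_left_le)
    show "(\<lambda>x. h x * r n (u x)) \<in> borel_measurable N" for n unfolding r_def by measurable
  qed (use h in auto)
  moreover have "(\<integral>x. h x * r n (u x) \<partial>N) = 0" for n
    unfolding r_def
    by (rule moments_zero_continuous[where \<phi> = "\<lambda>y. min 1 (max 0 (real n * (y - c)))", OF h u u01 mom])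
       (intro continuous_intros)
  ultimately show ?thesis by (simp add: LIMSEQ_const_iff)
qed

text \<open>Determinacy of the moment problem on \<open>[0, 1]\<close> for the signed measure with density \<open>h\<close>,
  transported by \<open>u\<close>: if all moments vanish, so does the integral of every bounded Borel function.
  The preceding two lemmas give the continuous functions, by the Weierstrass theorem, and then the
  half-lines, by dominated convergence; the half-lines determine the transported measures of the
  positive and negative part of \<open>h\<close>.\<close>

lemma moments_zero:
  fixes h u :: "'a \<Rightarrow> real"
  assumes h: "integrable N h" and u[measurable]: "u \<in> borel_measurable N"
    and u01: "\<And>x. u x \<in> {0..1}"
    and mom: "\<And>n. (\<integral>x. h x * u x ^ n \<partial>N) = 0"
    and \<phi>[measurable]: "\<phi> \<in> borel_measurable borel" and C: "\<And>y. \<bar>\<phi> y\<bar> \<le> C"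
  shows "(\<integral>x. h x * \<phi> (u x) \<partial>N) = 0"
proof -
  have [measurable]: "h \<in> borel_measurable N" using h by simp
  define D where "D f = distr (density N (\<lambda>x. ennreal (f x))) borel u" for f :: "'a \<Rightarrow> real"
  let ?p = "\<lambda>x. max 0 (h x)" and ?q = "\<lambda>x. max 0 (- h x)"
  have intp: "integrable N ?p" "integrable N ?q" using h by (auto intro: integrable_max)
  have em: "emeasure (D f) {c<..} = ennreal (\<integral>x. f x * indicator {c<..} (u x) \<partial>N)"
    if f: "integrable N f" "\<And>x. f x \<ge> 0" for f c
  proof -
    have [measurable]: "f \<in> borel_measurable N" using f by simp
    have int: "integrable N (\<lambda>x. f x * indicator {c<..} (u x))"
      using f by (intro Bochner_Integration.integrable_bound[OF f(1)]) (auto split: split_indicator)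
    have "emeasure (D f) {c<..} = emeasure (density N (\<lambda>x. ennreal (f x))) (u -` {c<..} \<inter> space N)"
      by (simp add: D_def emeasure_distr)
    also have "\<dots> = (\<integral>\<^sup>+x. ennreal (f x) * indicator (u -` {c<..} \<inter> space N) x \<partial>N)"
      by (subst emeasure_density) auto
    also have "\<dots> = (\<integral>\<^sup>+x. ennreal (f x * indicator {c<..} (u x)) \<partial>N)"
      by (intro nn_integral_cong) (auto split: split_indicator)
    also have "\<dots> = ennreal (\<integral>x. f x * indicator {c<..} (u x) \<partial>N)"
      using int f by (intro nn_integral_eq_integral) auto
    finally show ?thesis .
  qed
  have DD: "D ?p = D ?q"
  proof (rule measure_eqI_lessThan)
    show "emeasure (D ?p) {c<..} < \<infinity>" for c using em[OF intp(1)] by simp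
    fix c
    have i: "integrable N (\<lambda>x. f x * indicator {c<..} (u x))" if f: "integrable N f" for f :: "'a \<Rightarrow> real"
    proof -
      have [measurable]: "f \<in> borel_measurable N" using f by simp
      show ?thesis
        by (intro Bochner_Integration.integrable_bound[OF f]) (auto split: split_indicator)
    qed
    have "(\<integral>x. ?p x * indicator {c<..} (u x) \<partial>N) - (\<integral>x. ?q x * indicator {c<..} (u x) \<partial>N)
        = (\<integral>x. ?p x * indicator {c<..} (u x) - ?q x * indicator {c<..} (u x) \<partial>N)"
      using intp by (intro Bochner_Integration.integral_diff[symmetric] i)
    also have "\<dots> = (\<integral>x. h x * indicator {c<..} (u x) \<partial>N)"
      by (intro Bochner_Integration.integral_cong) (auto split: split_indicator)
    also have "\<dots> = 0" by (rule moments_zero_halfline[OF h u u01 mom])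
    finally show "emeasure (D ?p) {c<..} = emeasure (D ?q) {c<..}"
      using intp by (simp add: em)
  qed (simp_all add: D_def)
  have iD: "(\<integral>y. \<phi> y \<partial>D f) = (\<integral>x. f x * \<phi> (u x) \<partial>N)" if "f \<in> borel_measurable N" "\<And>x. f x \<ge> 0" for f
    using that by (simp add: D_def integral_distr integral_density)
  have "(\<integral>x. ?p x * \<phi> (u x) \<partial>N) = (\<integral>x. ?q x * \<phi> (u x) \<partial>N)"
    using iD[of ?p] iD[of ?q] by (simp add: DD)
  moreover have i: "integrable N (\<lambda>x. f x * \<phi> (u x))" if f: "integrable N f" for f
  proof -
    have [measurable]: "f \<in> borel_measurable N" using f by simp
    have "\<bar>f x * \<phi> (u x)\<bar> \<le> \<bar>C * f x\<bar>" for x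
      using C[of "u x"] mult_right_mono[of "\<bar>\<phi> (u x)\<bar>" "\<bar>C\<bar>" "\<bar>f x\<bar>"] by (simp add: abs_mult mult.commute)
    then show ?thesis
      using f by (intro Bochner_Integration.integrable_bound[OF integrable_mult_right[OF f, of C]]) auto
  qed
  moreover have "(\<integral>x. ?p x * \<phi> (u x) - ?q x * \<phi> (u x) \<partial>N) = (\<integral>x. h x * \<phi> (u x) \<partial>N)"
    by (intro Bochner_Integration.integral_cong) (auto simp: max_def)
  ultimately show ?thesis using Bochner_Integration.integral_diff[OF i i, OF intp] by simp
qed

lemma abs_x_gauss_le_1: "\<bar>t * exp (- t\<^sup>2)\<bar> \<le> (1::real)"
proof -
  have "\<bar>t\<bar> \<le> 1 + t\<^sup>2" using zero_le_power2[of "\<bar>t\<bar> - 1/2"] by (simp add: power2_eq_square algebra_simps)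
  also have "\<dots> \<le> exp (t\<^sup>2)" by (rule exp_ge_add_one_self)
  finally show ?thesis by (simp add: abs_mult exp_minus field_simps)
qed

text \<open>Determinacy by the functions \<open>exp (- n t\<^sup>2)\<close> and \<open>t exp (- n t\<^sup>2)\<close>. In the variable
  \<open>u = exp (- t\<^sup>2)\<close> the first family consists of the moments of \<open>h\<close> and the second one of those of
  \<open>h t exp (- t\<^sup>2)\<close>; they decide about the even and the odd test functions, respectively.\<close>

lemma gaussian_moments_zero_imp_AE_zero:
  fixes h :: "real \<Rightarrow> real"
  assumes sets[measurable_cong]: "sets N = sets borel"
    and h: "integrable N h"
    and even: "\<And>n::nat. (\<integral>t. h t * exp (- (real n * t\<^sup>2)) \<partial>N) = 0"
    and odd: "\<And>n::nat. n \<ge> 1 \<Longrightarrow> (\<integral>t. h t * (t * exp (- (real n * t\<^sup>2))) \<partial>N) = 0"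
  shows "AE t in N. h t = 0"
proof -
  have hm[measurable]: "h \<in> borel_measurable borel"
    using borel_measurable_integrable[OF h] by measurable
  define u :: "real \<Rightarrow> real" where "u t = exp (- t\<^sup>2)" for t
  define w :: "real \<Rightarrow> real" where "w t = t * exp (- t\<^sup>2)" for t
  define \<tau> :: "real \<Rightarrow> real" where "\<tau> y = sqrt (- ln y)" for y
  have [measurable]: "u \<in> borel_measurable borel" "w \<in> borel_measurable borel" "\<tau> \<in> borel_measurable borel"
    unfolding u_def w_def \<tau>_def by measurable
  have u01: "u t \<in> {0..1}" for t by (simp add: u_def)
  have \<tau>u: "\<tau> (u t) = \<bar>t\<bar>" for t by (simp add: \<tau>_def u_def)
  have w1: "\<bar>w t\<bar> \<le> 1" for t unfolding w_def by (rule abs_x_gauss_le_1)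
  have un: "u t ^ n = exp (- (real n * t\<^sup>2))" for t n
    by (simp add: u_def exp_of_nat_mult[symmetric])
  have bnd: "integrable N (\<lambda>t. h t * f t)" if [measurable]: "f \<in> borel_measurable borel" and "\<And>t. \<bar>f t\<bar> \<le> 1" for f
    using that(2) by (intro Bochner_Integration.integrable_bound[OF h] AE_I2) (auto simp: abs_mult intro!: mult_left_le)
  have E: "(\<integral>t. h t * \<phi> (u t) \<partial>N) = 0" if "\<phi> \<in> borel_measurable borel" "\<And>y. \<bar>\<phi> y\<bar> \<le> 1" for \<phi>
    by (rule moments_zero[OF h _ u01 _ that]) (simp_all add: un even)
  have O: "(\<integral>t. (h t * w t) * \<phi> (u t) \<partial>N) = 0" if "\<phi> \<in> borel_measurable borel" "\<And>y. \<bar>\<phi> y\<bar> \<le> 1" for \<phi>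
  proof (rule moments_zero[OF _ _ u01 _ that])
    show "integrable N (\<lambda>t. h t * w t)" by (intro bnd w1) simp
    have "w t * u t ^ n = t * exp (- (real (n + 1) * t\<^sup>2))" for t n
      by (simp add: un w_def exp_add[symmetric] algebra_simps)
    then show "(\<integral>t. (h t * w t) * u t ^ n \<partial>N) = 0" for n
      using odd[of "n + 1"] by (simp add: mult.assoc)
  qed simp
  have wg: "(\<integral>t. h t * (w t * g t) \<partial>N) = 0" if [measurable]: "g \<in> borel_measurable borel" and g1: "\<And>t. \<bar>g t\<bar> \<le> 1" for g
  proof -
    \<comment> \<open>The even part of \<open>w g\<close> is a function of \<open>t\<^sup>2\<close>, its odd part is \<open>w\<close> times such a function.\<close>
    define \<phi> where "\<phi> y = w (\<tau> y) * ((g (\<tau> y) - g (- \<tau> y)) / 2)" for y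
    define \<psi> where "\<psi> y = (g (\<tau> y) + g (- \<tau> y)) / 2" for y
    have [measurable]: "\<phi> \<in> borel_measurable borel" "\<psi> \<in> borel_measurable borel"
      unfolding \<phi>_def \<psi>_def by measurable
    have \<phi>1: "\<bar>\<phi> y\<bar> \<le> 1" for y
    proof -
      have "\<bar>(g (\<tau> y) - g (- \<tau> y)) / 2\<bar> \<le> 1" using g1[of "\<tau> y"] g1[of "- \<tau> y"] by simp
      then show ?thesis unfolding \<phi>_def abs_mult using w1[of "\<tau> y"] by (intro mult_le_one) auto
    qed
    have \<psi>1: "\<bar>\<psi> y\<bar> \<le> 1" for y using g1[of "\<tau> y"] g1[of "- \<tau> y"] by (simp add: \<psi>_def)
    have dec: "w t * g t = \<phi> (u t) + w t * \<psi> (u t)" for t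
      by (cases "t \<ge> 0") (simp_all add: \<phi>_def \<psi>_def \<tau>u w_def field_simps)
    have "(\<integral>t. h t * (w t * g t) \<partial>N) = (\<integral>t. h t * \<phi> (u t) + h t * (w t * \<psi> (u t)) \<partial>N)"
      by (simp only: dec distrib_left)
    also have "\<dots> = (\<integral>t. h t * \<phi> (u t) \<partial>N) + (\<integral>t. h t * (w t * \<psi> (u t)) \<partial>N)"
      using \<phi>1 \<psi>1 w1 by (intro Bochner_Integration.integral_add bnd) (auto simp: abs_mult intro!: mult_le_one)
    also have "\<dots> = 0" using E[of \<phi>] O[of \<psi>] \<phi>1 \<psi>1 by (simp add: mult.assoc)
    finally show ?thesis .
  qed
  \<comment> \<open>This choice of \<open>g\<close> makes the integrand nonnegative. As \<open>w\<close> vanishes at \<open>0\<close>, a possible atom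
    there is treated separately.\<close>
  have "(\<integral>t. h t * (w t * sgn (h t * t)) \<partial>N) = 0"
    by (rule wg) (auto simp: sgn_if)
  moreover have "h t * (w t * sgn (h t * t)) = \<bar>h t * t\<bar> * exp (- t\<^sup>2)" for t
    by (simp add: w_def sgn_mult abs_mult abs_sgn mult_ac)
  moreover have "integrable N (\<lambda>t. h t * (w t * sgn (h t * t)))"
    using w1 by (intro bnd) (auto simp: sgn_if abs_mult intro!: mult_le_one)
  ultimately have 1: "AE t in N. \<bar>h t * t\<bar> * exp (- t\<^sup>2) = 0"
    by (subst integral_nonneg_eq_0_iff_AE[symmetric]) auto
  have "(\<integral>t. h t * (sgn (h 0) * indicator {1} (u t)) \<partial>N) = 0"
    by (rule E) (auto simp: sgn_if split: split_indicator)
  moreover have "h t * (sgn (h 0) * indicator {1} (u t)) = \<bar>h t\<bar> * indicator {0} t" for t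
    by (auto simp: u_def abs_sgn split: split_indicator)
  moreover have "integrable N (\<lambda>t. h t * (sgn (h 0) * indicator {1} (u t)))"
    by (intro bnd) (auto simp: sgn_if split: split_indicator)
  ultimately have 2: "AE t in N. \<bar>h t\<bar> * indicator {0} t = 0"
    by (subst integral_nonneg_eq_0_iff_AE[symmetric]) auto
  from 1 2 show ?thesis by eventually_elim (auto split: split_indicator_asm)
qed

lemma integrable_pair_mult:
  fixes f :: "'a \<Rightarrow> real" and g :: "'b \<Rightarrow> real"
  assumes "sigma_finite_measure N" and f: "integrable M f" and g: "integrable N g"
  shows "integrable (M \<Otimes>\<^sub>M N) (\<lambda>(x, y). f x * g y)"
proof (rule integrableI_bounded)
  interpret sigma_finite_measure N by fact
  have [measurable]: "f \<in> borel_measurable M" "g \<in> borel_measurable N" using f g by auto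
  show "(\<lambda>(x, y). f x * g y) \<in> borel_measurable (M \<Otimes>\<^sub>M N)" by measurable
  have "(\<integral>\<^sup>+p. ennreal (norm (case p of (x, y) \<Rightarrow> f x * g y)) \<partial>(M \<Otimes>\<^sub>M N))
      = (\<integral>\<^sup>+x. \<integral>\<^sup>+y. ennreal \<bar>f x\<bar> * ennreal \<bar>g y\<bar> \<partial>N \<partial>M)"
    by (subst nn_integral_fst[symmetric]) (simp_all add: abs_mult ennreal_mult)
  also have "\<dots> = (\<integral>\<^sup>+x. ennreal \<bar>f x\<bar> \<partial>M) * (\<integral>\<^sup>+y. ennreal \<bar>g y\<bar> \<partial>N)"
    by (simp add: nn_integral_cmult nn_integral_multc)
  also have "\<dots> < \<infinity>"
    using f g by (simp add: integrable_iff_bounded ennreal_mult_less_top less_top[symmetric] ennreal_mult_eq_top_iff)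
  finally show "(\<integral>\<^sup>+p. ennreal (norm (case p of (x, y) \<Rightarrow> f x * g y)) \<partial>(M \<Otimes>\<^sub>M N)) < \<infinity>" .
qed

section \<open>Injectivity of the Dunkl transform of positive measures\<close>

text \<open>If the integrals of \<open>h\<close> against all dilates of the kernel \<open>K\<close> vanish, so does its integral
  against any Gamma-weighted average of these dilates. This is Fubini's theorem; the growth bound on
  \<open>K\<close> gives the integrable majorant.\<close>

lemma gamma_average_zero:
  fixes h K :: "real \<Rightarrow> real"
  assumes N: "sigma_finite_measure N" and sets[measurable_cong]: "sets N = sets borel"
    and h: "integrable N h" "integrable N (\<lambda>t. h t * \<bar>t\<bar> powr k)" and k: "k \<ge> 0"
    and K: "continuous_on UNIV K" "\<And>y. \<bar>K y\<bar> \<le> C * (1 + \<bar>y\<bar> powr k)"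
    and s: "s > 0" and zero: "\<And>x. (\<integral>t. h t * K (x * t) \<partial>N) = 0"
  shows "(\<integral>t. h t * (\<integral>u. K (c * t * sqrt u) * gamma_weight s u \<partial>lborel) \<partial>N) = 0"
proof -
  interpret N: sigma_finite_measure N by fact
  interpret pair_sigma_finite N lborel ..
  have [measurable]: "h \<in> borel_measurable borel"
    using borel_measurable_integrable[OF h(1)] by measurable
  have [measurable]: "K \<in> borel_measurable borel" using K(1) by (rule borel_measurable_continuous_onI)
  define F where "F t u = h t * (K (c * t * sqrt u) * gamma_weight s u)" for t u
  define P where "P t = \<bar>C\<bar> * (h t + h t * \<bar>t\<bar> powr k)" for t
  define R where "R u = gamma_weight s u + \<bar>c\<bar> powr k * gamma_weight (s + k / 2) u" for u
  have bound: "\<bar>F t u\<bar> \<le> \<bar>P t * R u\<bar>" for t u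
  proof (cases "u > 0")
    case True
    have "C \<ge> 0" using order_trans[OF abs_ge_zero K(2)[of 1]] by simp
    have ku: "\<bar>c * t * sqrt u\<bar> powr k = \<bar>c\<bar> powr k * \<bar>t\<bar> powr k * u powr (k / 2)"
      using True by (simp add: abs_mult powr_mult powr_half_sqrt[symmetric] powr_powr)
    have "\<bar>K (c * t * sqrt u)\<bar> \<le> C * (1 + \<bar>c\<bar> powr k * \<bar>t\<bar> powr k * u powr (k / 2))"
      using K(2)[of "c * t * sqrt u"] by (simp only: ku)
    also have "\<dots> \<le> C * ((1 + \<bar>t\<bar> powr k) * (1 + \<bar>c\<bar> powr k * u powr (k / 2)))"
      using \<open>C \<ge> 0\<close> by (intro mult_left_mono) (simp_all add: algebra_simps)
    finally have "\<bar>F t u\<bar> \<le> \<bar>h t\<bar> * ((C * ((1 + \<bar>t\<bar> powr k) * (1 + \<bar>c\<bar> powr k * u powr (k / 2))))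
        * gamma_weight s u)"
      unfolding F_def abs_mult abs_of_nonneg[OF gamma_weight_nonneg]
      by (intro mult_left_mono mult_right_mono) (auto simp: gamma_weight_nonneg)
    also have "\<dots> = \<bar>C * (h t * (1 + \<bar>t\<bar> powr k))\<bar>
        * \<bar>gamma_weight s u * (1 + \<bar>c\<bar> powr k * u powr (k / 2))\<bar>"
      using \<open>C \<ge> 0\<close> gamma_weight_nonneg[of s u] by (simp add: abs_mult mult_ac)
    also have "C * (h t * (1 + \<bar>t\<bar> powr k)) = P t"
      using \<open>C \<ge> 0\<close> by (simp add: P_def distrib_left)
    also have "gamma_weight s u * (1 + \<bar>c\<bar> powr k * u powr (k / 2)) = R u"
      by (simp add: R_def gamma_weight_powr[symmetric] algebra_simps)
    also have "\<bar>P t\<bar> * \<bar>R u\<bar> = \<bar>P t * R u\<bar>" by (simp only: abs_mult)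
    finally show ?thesis .
  qed (simp add: F_def gamma_weight_def)
  have "integrable (N \<Otimes>\<^sub>M lborel) (case_prod F)"
  proof (rule Bochner_Integration.integrable_bound)
    have "integrable N P" unfolding P_def using h by auto
    moreover have "integrable lborel R"
      unfolding R_def using s k has_bochner_integral_gamma_weight[of s] has_bochner_integral_gamma_weight[of "s + k / 2"]
      by (intro Bochner_Integration.integrable_add integrable_mult_right) (auto simp: has_bochner_integral_iff)
    ultimately show "integrable (N \<Otimes>\<^sub>M lborel) (\<lambda>(t, u). P t * R u)"
      by (intro integrable_pair_mult lborel.sigma_finite_measure_axioms)
    show "case_prod F \<in> borel_measurable (N \<Otimes>\<^sub>M lborel)" unfolding F_def by measurable
    show "AE x in N \<Otimes>\<^sub>M lborel. norm (case_prod F x) \<le> norm (case x of (t, u) \<Rightarrow> P t * R u)"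
      using bound by (intro AE_I2) auto
  qed
  from Fubini_integral[OF this]
  have "(\<integral>t. (\<integral>u. F t u \<partial>lborel) \<partial>N) = (\<integral>u. (\<integral>t. F t u \<partial>N) \<partial>lborel)" by simp
  also have "\<dots> = 0"
  proof -
    have "(\<integral>t. F t u \<partial>N) = gamma_weight s u * (\<integral>t. h t * K (c * sqrt u * t) \<partial>N)" for u
      unfolding F_def by (subst integral_mult_right_zero[symmetric]) (simp add: mult_ac)
    then show ?thesis by (simp add: zero)
  qed
  finally show ?thesis by (simp add: F_def)
qed

lemma dunkl_transform_density_zero:
  fixes h :: "real \<Rightarrow> real"
  assumes \<mu>: "\<mu> > -1/2" and N: "sigma_finite_measure N" and sets: "sets N = sets borel"
    and h: "integrable N h" "integrable N (\<lambda>t. h t * \<bar>t\<bar> powr max 0 (-\<mu>))"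
    and cos: "\<And>x. (\<integral>t. h t * dunkl_cos \<mu> (x * t) \<partial>N) = 0"
    and sin: "\<And>x. (\<integral>t. h t * dunkl_sin \<mu> (x * t) \<partial>N) = 0"
  shows "AE t in N. h t = 0"
proof (rule gaussian_moments_zero_imp_AE_zero[OF sets h(1)])
  obtain C where C: "\<And>y. \<bar>dunkl_cos \<mu> y\<bar> \<le> C * (1 + \<bar>y\<bar> powr max 0 (-\<mu>))"
    "\<And>y. \<bar>dunkl_sin \<mu> y\<bar> \<le> C * (1 + \<bar>y\<bar> powr max 0 (-\<mu>))"
    using dunkl_cos_sin_bound[OF \<mu>] by blast
  have G: "Gamma (\<mu> + 1/2) > 0" using \<mu> by (intro Gamma_real_pos) auto
  fix n :: nat
  \<comment> \<open>The dilation that turns \<open>exp (- (c t)\<^sup>2 / 4)\<close> into the Gaussian \<open>exp (- n t\<^sup>2)\<close>.\<close>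
  define c where "c = 2 * sqrt (real n)"
  have c: "(c * t)\<^sup>2 / 4 = real n * t\<^sup>2" for t by (simp add: c_def power_mult_distrib)
  have "(\<integral>t. h t * (\<integral>u. dunkl_cos \<mu> (c * t * sqrt u) * gamma_weight (\<mu> + 1/2) u \<partial>lborel) \<partial>N) = 0"
    by (rule gamma_average_zero[OF N sets h _ continuous_dunkl_cos[OF \<mu>] C(1) _ cos]) (use \<mu> in auto)
  then have "(\<integral>t. Gamma (\<mu> + 1/2) * (h t * exp (- (real n * t\<^sup>2))) \<partial>N) = 0"
    by (simp only: dunkl_cos_gamma_integral[OF \<mu>] c mult.left_commute)
  then show "(\<integral>t. h t * exp (- (real n * t\<^sup>2)) \<partial>N) = 0"
    using G by (simp add: less_imp_neq[symmetric])
  have "(\<integral>t. h t * (\<integral>u. dunkl_sin \<mu> (c * t * sqrt u) * gamma_weight (\<mu> + 1) u \<partial>lborel) \<partial>N) = 0"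
    by (rule gamma_average_zero[OF N sets h _ continuous_dunkl_sin[OF \<mu>] C(2) _ sin]) (use \<mu> in auto)
  moreover have "h t * (\<integral>u. dunkl_sin \<mu> (c * t * sqrt u) * gamma_weight (\<mu> + 1) u \<partial>lborel)
      = Gamma (\<mu> + 1/2) * c / 2 * (h t * (t * exp (- (real n * t\<^sup>2))))" for t
    unfolding dunkl_sin_gamma_integral[OF \<mu>] c by (simp add: mult_ac)
  ultimately have "Gamma (\<mu> + 1/2) * c / 2 * (\<integral>t. h t * (t * exp (- (real n * t\<^sup>2))) \<partial>N) = 0"
    by simp
  then show "(\<integral>t. h t * (t * exp (- (real n * t\<^sup>2))) \<partial>N) = 0" if "n \<ge> 1"
    using G that by (simp add: c_def less_imp_neq[symmetric])
qed

lemma dunkl_exp_i: "dunkl_exp \<mu> (\<i> * of_real x * of_real t) = Complex (dunkl_cos \<mu> (x * t)) (dunkl_sin \<mu> (x * t))"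
  by (simp add: dunkl_cos_def dunkl_sin_def complex_eq_iff mult.assoc)

lemma integrable_dunkl_cos_sin:
  assumes \<mu>: "\<mu> > -1/2" and P: "finite_measure P" and sets[measurable_cong]: "sets P = sets borel"
    and int: "integrable P (\<lambda>t. \<bar>t\<bar> powr max 0 (-\<mu>))"
  shows "integrable P (\<lambda>t. dunkl_cos \<mu> (x * t))" "integrable P (\<lambda>t. dunkl_sin \<mu> (x * t))"
proof -
  interpret finite_measure P by fact
  let ?k = "max 0 (-\<mu>)"
  obtain C where C: "\<And>y. \<bar>dunkl_cos \<mu> y\<bar> \<le> C * (1 + \<bar>y\<bar> powr ?k)"
    "\<And>y. \<bar>dunkl_sin \<mu> y\<bar> \<le> C * (1 + \<bar>y\<bar> powr ?k)"
    using dunkl_cos_sin_bound[OF \<mu>] by blast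
  have i: "integrable P (\<lambda>t. C * (1 + \<bar>x\<bar> powr ?k * \<bar>t\<bar> powr ?k))"
    using int by (intro integrable_mult_right Bochner_Integration.integrable_add) auto
  have k: "\<bar>x * t\<bar> powr ?k = \<bar>x\<bar> powr ?k * \<bar>t\<bar> powr ?k" for t
    by (simp add: abs_mult powr_mult)
  have [measurable]: "dunkl_cos \<mu> \<in> borel_measurable borel" "dunkl_sin \<mu> \<in> borel_measurable borel"
    using continuous_dunkl_cos[OF \<mu>] continuous_dunkl_sin[OF \<mu>]
    by (auto intro: borel_measurable_continuous_onI)
  have "norm (dunkl_cos \<mu> (x * t)) \<le> norm (C * (1 + \<bar>x\<bar> powr ?k * \<bar>t\<bar> powr ?k))"
    "norm (dunkl_sin \<mu> (x * t)) \<le> norm (C * (1 + \<bar>x\<bar> powr ?k * \<bar>t\<bar> powr ?k))" for t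
    unfolding real_norm_def k[symmetric] by (rule order_trans[OF C(1) abs_ge_self] order_trans[OF C(2) abs_ge_self])+
  then show "integrable P (\<lambda>t. dunkl_cos \<mu> (x * t))" "integrable P (\<lambda>t. dunkl_sin \<mu> (x * t))"
    by (auto intro!: Bochner_Integration.integrable_bound[OF i] AE_I2)
qed

text \<open>The majorant is \<open>P + Q\<close>.\<close>

lemma finite_common_majorant:
  fixes P Q :: "'a measure"
  assumes "finite_measure P" "finite_measure Q" "sets P = sets Q"
  obtains T where "finite_measure T" "sets T = sets P" "absolutely_continuous T P" "absolutely_continuous T Q"
proof
  interpret P: finite_measure P by fact
  interpret Q: finite_measure Q by fact
  define T where "T = measure_of (space P) (sets P) (\<lambda>E. emeasure P E + emeasure Q E)"
  show s: "sets T = sets P" by (simp add: T_def)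
  have em: "emeasure T E = emeasure P E + emeasure Q E" if "E \<in> sets P" for E
    unfolding T_def
  proof (rule emeasure_measure_of_sigma[OF _ _ _ that])
    show "sigma_algebra (space P) (sets P)" by (rule sets.sigma_algebra_axioms)
    show "positive (sets P) (\<lambda>E. emeasure P E + emeasure Q E)" by (simp add: positive_def)
    show "countably_additive (sets P) (\<lambda>E. emeasure P E + emeasure Q E)"
      using assms(3) by (intro countably_additiveI) (simp add: suminf_add[symmetric] suminf_emeasure)
  qed
  show "finite_measure T"
    using em[OF sets.top] by (intro finite_measureI) (simp add: sets_eq_imp_space_eq[OF s])
  show "absolutely_continuous T P" "absolutely_continuous T Q"
    using assms(3) s by (auto simp: absolutely_continuous_def null_sets_def em)
qed

text \<open>The measures are compared through their densities with respect to a common majorant, which reduces the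
  claim to the vanishing of one real density.\<close>

theorem dunkl_transform_injective:
  fixes P Q :: "real measure"
  assumes \<mu>: "\<mu> > -1/2"
    and fin: "finite_measure P" "finite_measure Q"
    and sets: "sets P = sets borel" "sets Q = sets borel"
    and int: "integrable P (\<lambda>t. \<bar>t\<bar> powr max 0 (-\<mu>))" "integrable Q (\<lambda>t. \<bar>t\<bar> powr max 0 (-\<mu>))"
    and cos: "\<And>x. (\<integral>t. dunkl_cos \<mu> (x * t) \<partial>P) = (\<integral>t. dunkl_cos \<mu> (x * t) \<partial>Q)"
    and sin: "\<And>x. (\<integral>t. dunkl_sin \<mu> (x * t) \<partial>P) = (\<integral>t. dunkl_sin \<mu> (x * t) \<partial>Q)"
  shows "P = Q"
proof -
  have "sets P = sets Q" using sets by simp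
  from finite_common_majorant[OF fin this] obtain T where T: "finite_measure T" "sets T = sets P"
    "absolutely_continuous T P" "absolutely_continuous T Q" .
  interpret T: finite_measure T by (rule T)
  have sT[measurable_cong]: "sets T = sets borel" using T(2) sets by simp
  have dens: "\<exists>D. D \<in> borel_measurable borel \<and> (\<forall>t. D t \<ge> 0) \<and> R = density T (\<lambda>t. ennreal (D t))"
    if R: "finite_measure R" "absolutely_continuous T R" "sets R = sets T" for R
  proof -
    from T.real_RN_deriv[OF R] obtain D where D: "D \<in> borel_measurable T"
      "AE t in T. RN_deriv T R t = ennreal (D t)" "\<And>t. 0 \<le> D t" by metis
    have "R = density T (RN_deriv T R)" using T.density_RN_deriv[OF R(2,3)] by simp
    also have "\<dots> = density T (\<lambda>t. ennreal (D t))"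
      using D by (intro density_cong) auto
    finally show ?thesis using D by (auto simp: measurable_cong_sets[OF sT refl])
  qed
  obtain D E where D[measurable]: "D \<in> borel_measurable borel" and D0: "\<And>t. D t \<ge> 0"
      and PD: "P = density T (\<lambda>t. ennreal (D t))"
    and E[measurable]: "E \<in> borel_measurable borel" and E0: "\<And>t. E t \<ge> 0"
      and QE: "Q = density T (\<lambda>t. ennreal (E t))"
    using dens[OF fin(1) T(3)] dens[OF fin(2) T(4)] T(2) sets by auto
  have iD: "integrable T (\<lambda>t. D t * f t)" "(\<integral>t. f t \<partial>P) = (\<integral>t. D t * f t \<partial>T)"
    if "integrable P f" for f :: "real \<Rightarrow> real"
  proof -
    have f: "f \<in> borel_measurable T" using borel_measurable_integrable[OF that] T(2) by (simp cong: measurable_cong_sets)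
    then show "integrable T (\<lambda>t. D t * f t)"
      using that D0 integrable_density[of f T D] by (simp add: PD)
    show "(\<integral>t. f t \<partial>P) = (\<integral>t. D t * f t \<partial>T)"
      using f D0 integral_density[of f T D] by (simp add: PD)
  qed
  have iE: "integrable T (\<lambda>t. E t * f t)" "(\<integral>t. f t \<partial>Q) = (\<integral>t. E t * f t \<partial>T)"
    if "integrable Q f" for f :: "real \<Rightarrow> real"
  proof -
    have f: "f \<in> borel_measurable T" using borel_measurable_integrable[OF that] T(2) sets by (simp cong: measurable_cong_sets)
    then show "integrable T (\<lambda>t. E t * f t)"
      using that E0 integrable_density[of f T E] by (simp add: QE)
    show "(\<integral>t. f t \<partial>Q) = (\<integral>t. E t * f t \<partial>T)"
      using f E0 integral_density[of f T E] by (simp add: QE)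
  qed
  have diff: "integrable T (\<lambda>t. (D t - E t) * f t)"
    "(\<integral>t. (D t - E t) * f t \<partial>T) = (\<integral>t. f t \<partial>P) - (\<integral>t. f t \<partial>Q)"
    if "integrable P f" "integrable Q f" for f :: "real \<Rightarrow> real"
    using iD[OF that(1)] iE[OF that(2)] by (simp_all add: left_diff_distrib)
  have one: "integrable P (\<lambda>_. 1 :: real)" "integrable Q (\<lambda>_. 1 :: real)"
    using fin by (simp_all add: finite_measure.integrable_const)
  note ic = integrable_dunkl_cos_sin[OF \<mu> fin(1) sets(1) int(1)]
    integrable_dunkl_cos_sin[OF \<mu> fin(2) sets(2) int(2)]
  have "AE t in T. D t - E t = 0"
    by (rule dunkl_transform_density_zero[OF \<mu> T.sigma_finite_measure_axioms sT _ diff(1)[OF int]])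
       (use diff(1)[OF one] diff(2)[OF ic(1,3)] diff(2)[OF ic(2,4)] cos sin in simp_all)
  then show "P = Q" unfolding PD QE by (intro density_cong) auto
qed

section \<open>Complex measures\<close>

lemma sets_total_variation [simp]: "sets (total_variation M \<nu>) = sets M"
  by (simp add: total_variation_def)

lemma sets_positive_part [simp]: "sets (positive_part M \<sigma>) = sets M"
  by (simp add: positive_part_def)

lemma positive_part_le_total_variation:
  assumes \<nu>: "complex_measure M \<nu>" and L: "bounded_linear L" "\<And>z. \<bar>L z\<bar> \<le> cmod z" and E: "E \<in> sets M"
  shows "emeasure (positive_part M (\<lambda>E. L (\<nu> E))) E \<le> emeasure (total_variation M \<nu>) E"
  unfolding emeasure_positive_part[OF \<nu> E L(1)] emeasure_total_variation[OF \<nu> E] positive_part_on_def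
proof (rule SUP_least)
  fix F assume F: "F \<in> {F \<in> sets M. F \<subseteq> E}"
  have "ennreal (L (\<nu> F)) \<le> ennreal (cmod (\<nu> F))" using L(2)[of "\<nu> F"] by (intro ennreal_leI) simp
  also have "\<dots> \<le> (\<Sum>A\<in>{F, E - F}. ennreal (cmod (\<nu> A)))" by (rule member_le_sum) auto
  also have "\<dots> \<le> total_variation_on M \<nu> E"
    unfolding total_variation_on_def using F E by (intro SUP_upper) (auto simp: disjoint_def)
  finally show "ennreal (L (\<nu> F)) \<le> total_variation_on M \<nu> E" .
qed

text \<open>Let \<open>\<sigma> = L \<circ> \<nu>\<close>. Where \<open>\<sigma>(E) > 0\<close>, the sum of \<open>\<sigma>(E)\<close> and the negative part of \<open>E\<close> is at most
  the positive part of \<open>E\<close>; this half of the Jordan decomposition suffices.\<close>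

lemma positive_parts_eq_imp_nonpos:
  assumes \<nu>: "complex_measure M \<nu>" and L: "bounded_linear L" and E: "E \<in> sets M"
    and eq: "emeasure (positive_part M (\<lambda>E. L (\<nu> E))) E = emeasure (positive_part M (\<lambda>E. - L (\<nu> E))) E"
    and fin: "emeasure (positive_part M (\<lambda>E. L (\<nu> E))) E < \<infinity>"
  shows "L (\<nu> E) \<le> 0"
proof (rule ccontr)
  assume "\<not> L (\<nu> E) \<le> 0"
  then have pos: "L (\<nu> E) > 0" by simp
  interpret L: bounded_linear L by fact
  note p = emeasure_positive_part[OF \<nu> E L] emeasure_positive_part[OF \<nu> E bounded_linear_minus[OF L]]
  have "(SUP A\<in>{E}. ennreal (L (\<nu> A))) + (SUP F\<in>{F \<in> sets M. F \<subseteq> E}. ennreal (- L (\<nu> F)))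
      \<le> positive_part_on M (\<lambda>E. L (\<nu> E)) E"
  proof (rule ennreal_SUP_add_le)
    fix A F assume A: "A \<in> {E}" and F: "F \<in> {F \<in> sets M. F \<subseteq> E}"
    have up: "ennreal (L (\<nu> G)) \<le> positive_part_on M (\<lambda>E. L (\<nu> E)) E" if "G \<in> sets M" "G \<subseteq> E" for G
      unfolding positive_part_on_def using that by (intro SUP_upper) auto
    show "ennreal (L (\<nu> A)) + ennreal (- L (\<nu> F)) \<le> positive_part_on M (\<lambda>E. L (\<nu> E)) E"
    proof (cases "L (\<nu> F) \<ge> 0")
      case True
      then show ?thesis using up[OF E] A by (simp add: ennreal_neg)
    next
      case False
      have "\<nu> (F \<union> (E - F)) = \<nu> F + \<nu> (E - F)" using F E by (intro complex_measure_Un[OF \<nu>]) auto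
      moreover have "F \<union> (E - F) = E" using F by auto
      ultimately have "L (\<nu> E) + (- L (\<nu> F)) = L (\<nu> (E - F))" by (simp add: L.add)
      then have "ennreal (L (\<nu> A)) + ennreal (- L (\<nu> F)) = ennreal (L (\<nu> (E - F)))"
        using A pos False by (simp add: ennreal_plus[symmetric] del: ennreal_plus)
      then show ?thesis using up[of "E - F"] F E by auto
    qed
  qed auto
  then have "ennreal (L (\<nu> E)) + positive_part_on M (\<lambda>E. - L (\<nu> E)) E \<le> positive_part_on M (\<lambda>E. L (\<nu> E)) E"
    by (simp add: positive_part_on_def[of _ "\<lambda>E. - L (\<nu> E)"])
  then have le: "ennreal (L (\<nu> E)) + positive_part_on M (\<lambda>E. L (\<nu> E)) E \<le> positive_part_on M (\<lambda>E. L (\<nu> E)) E"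
    using eq by (simp add: p)
  moreover have "positive_part_on M (\<lambda>E. L (\<nu> E)) E < \<infinity>" using fin by (simp add: p)
  ultimately show False using pos
    by (cases "positive_part_on M (\<lambda>E. L (\<nu> E)) E") (auto simp: ennreal_plus[symmetric] simp del: ennreal_plus)
qed

text \<open>For a functional \<open>L\<close> of norm at most \<open>1\<close>, such as the real or imaginary part, the positive part of \<open>L \<circ> \<nu>\<close> inherits
  finiteness and integrability from the total variation, which dominates it.\<close>

lemma positive_part_properties:
  fixes \<nu> :: "real set \<Rightarrow> complex"
  assumes S: "S \<in> sets borel" and \<nu>: "complex_measure (restrict_space borel S) \<nu>"
    and L: "bounded_linear L" "\<And>z. \<bar>L z\<bar> \<le> cmod z"
    and fin: "(\<integral>\<^sup>+t. ennreal (\<bar>t\<bar> powr k + 1) \<partial>total_variation (restrict_space borel S) \<nu>) < \<infinity>"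
    and P: "P = positive_part (restrict_space borel S) (\<lambda>E. L (\<nu> E))"
  shows "sets P = sets (restrict_space borel S)" "finite_measure P" "integrable P (\<lambda>t. \<bar>t\<bar> powr k)"
    "(\<lambda>t. t) \<in> borel_measurable P"
proof -
  let ?M = "restrict_space borel S" and ?T = "total_variation (restrict_space borel S) \<nu>"
  show sP: "sets P = sets ?M" by (simp add: P)
  have sT: "sets ?T = sets ?M" by simp
  have id: "(\<lambda>t. t) \<in> borel_measurable ?M" by (rule measurable_restrict_space1) simp
  show idP: "(\<lambda>t. t) \<in> borel_measurable P" using id by (simp cong: measurable_cong_sets add: sP)
  have "emeasure P E \<le> emeasure ?T E" for E
  proof (cases "E \<in> sets ?M")
    case True
    then show ?thesis using positive_part_le_total_variation[OF \<nu> L] by (simp add: P)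
  next
    case False
    then show ?thesis by (simp add: emeasure_notin_sets sP)
  qed
  moreover have "sets P = sets ?T" by (simp only: sP sT)
  moreover from this have "space P = space ?T" by (rule sets_eq_imp_space_eq)
  ultimately have "P \<le> ?T" by (simp add: le_measure_iff le_fun_def)
  then have "(\<integral>\<^sup>+t. ennreal (\<bar>t\<bar> powr k + 1) \<partial>P) \<le> (\<integral>\<^sup>+t. ennreal (\<bar>t\<bar> powr k + 1) \<partial>?T)"
    by (intro nn_integral_mono_measure) (simp_all add: sP sT)
  then have finP: "(\<integral>\<^sup>+t. ennreal (\<bar>t\<bar> powr k + 1) \<partial>P) < \<infinity>" using fin by (rule le_less_trans)
  have "emeasure P (space P) = (\<integral>\<^sup>+t. 1 \<partial>P)" by simp
  also have "\<dots> \<le> (\<integral>\<^sup>+t. ennreal (\<bar>t\<bar> powr k + 1) \<partial>P)" by (intro nn_integral_mono) simp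
  finally show "finite_measure P" using finP by (intro finite_measureI) auto
  show "integrable P (\<lambda>t. \<bar>t\<bar> powr k)"
  proof (rule integrableI_bounded)
    have "(\<integral>\<^sup>+t. ennreal (norm (\<bar>t\<bar> powr k)) \<partial>P) \<le> (\<integral>\<^sup>+t. ennreal (\<bar>t\<bar> powr k + 1) \<partial>P)"
      by (intro nn_integral_mono) (auto intro!: ennreal_leI)
    then show "(\<integral>\<^sup>+t. ennreal (norm (\<bar>t\<bar> powr k)) \<partial>P) < \<infinity>" using finP by (rule le_less_trans)
  qed (use idP in measurable)
qed

text \<open>A signed measure whose Dunkl transform vanishes is zero. The push-forward under the identity
  extends its positive and negative part from \<open>S\<close> to Borel measures on the line.\<close>

lemma dunkl_transform_signed_zero:
  fixes \<nu> :: "real set \<Rightarrow> complex"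
  assumes \<mu>: "\<mu> > -1/2" and S: "S \<in> sets borel" and \<nu>: "complex_measure (restrict_space borel S) \<nu>"
    and L: "bounded_linear L" "\<And>z. \<bar>L z\<bar> \<le> cmod z"
    and fin: "(\<integral>\<^sup>+t. ennreal (\<bar>t\<bar> powr max 0 (-\<mu>) + 1) \<partial>total_variation (restrict_space borel S) \<nu>) < \<infinity>"
    and P: "P = positive_part (restrict_space borel S) (\<lambda>E. L (\<nu> E))"
    and Q: "Q = positive_part (restrict_space borel S) (\<lambda>E. - L (\<nu> E))"
    and cos: "\<And>x. (\<integral>t. dunkl_cos \<mu> (x * t) \<partial>P) = (\<integral>t. dunkl_cos \<mu> (x * t) \<partial>Q)"
    and sin: "\<And>x. (\<integral>t. dunkl_sin \<mu> (x * t) \<partial>P) = (\<integral>t. dunkl_sin \<mu> (x * t) \<partial>Q)"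
    and E: "E \<in> sets (restrict_space borel S)"
  shows "L (\<nu> E) = 0"
proof -
  have L': "bounded_linear (\<lambda>z. - L z)" "\<And>z. \<bar>- L z\<bar> \<le> cmod z"
    using L by (auto intro: bounded_linear_minus)
  note p = positive_part_properties[OF S \<nu> L fin P] and q = positive_part_properties[OF S \<nu> L' fin Q]
  have [measurable]: "dunkl_cos \<mu> \<in> borel_measurable borel" "dunkl_sin \<mu> \<in> borel_measurable borel"
    using continuous_dunkl_cos[OF \<mu>] continuous_dunkl_sin[OF \<mu>]
    by (auto intro: borel_measurable_continuous_onI)
  have PQ: "distr P borel (\<lambda>t. t) = distr Q borel (\<lambda>t. t)"
  proof (rule dunkl_transform_injective[OF \<mu>])
    show "finite_measure (distr P borel (\<lambda>t. t))" by (rule finite_measure.finite_measure_distr[OF p(2,4)])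
    show "finite_measure (distr Q borel (\<lambda>t. t))" by (rule finite_measure.finite_measure_distr[OF q(2,4)])
  qed (use p q cos sin in \<open>simp_all add: integrable_distr_eq integral_distr\<close>)
  have E': "E \<in> sets borel" using E S by (auto simp: sets_restrict_space_iff)
  have "E \<in> sets P" "E \<in> sets Q" using E p(1) q(1) by simp_all
  then have "(\<lambda>t. t) -` E \<inter> space P = E" "(\<lambda>t. t) -` E \<inter> space Q = E"
    using sets.sets_into_space by auto
  then have eq: "emeasure P E = emeasure Q E"
    using emeasure_distr[OF p(4) E'] emeasure_distr[OF q(4) E'] PQ by simp
  have fE: "emeasure P E < \<infinity>" "emeasure Q E < \<infinity>"
    using finite_measure.emeasure_finite[OF p(2)] finite_measure.emeasure_finite[OF q(2)] by (auto simp: less_top)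
  have "L (\<nu> E) \<le> 0" using positive_parts_eq_imp_nonpos[OF \<nu> L(1) E] eq fE by (simp add: P Q)
  moreover have "- L (\<nu> E) \<le> 0" using positive_parts_eq_imp_nonpos[OF \<nu> L'(1) E] eq fE by (simp add: P Q)
  ultimately show ?thesis by simp
qed

lemma integral_dunkl_exp:
  assumes \<mu>: "\<mu> > -1/2" and P: "finite_measure P" "(\<lambda>t. t) \<in> borel_measurable P"
    and int: "integrable P (\<lambda>t. \<bar>t\<bar> powr max 0 (-\<mu>))"
  shows "(\<integral>t. dunkl_exp \<mu> (\<i> * of_real x * of_real t) \<partial>P)
    = Complex (\<integral>t. dunkl_cos \<mu> (x * t) \<partial>P) (\<integral>t. dunkl_sin \<mu> (x * t) \<partial>P)"
proof -
  let ?D = "distr P borel (\<lambda>t. t)"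
  have [measurable]: "dunkl_cos \<mu> \<in> borel_measurable borel" "dunkl_sin \<mu> \<in> borel_measurable borel"
    using continuous_dunkl_cos[OF \<mu>] continuous_dunkl_sin[OF \<mu>]
    by (auto intro: borel_measurable_continuous_onI)
  have "integrable ?D (\<lambda>t. dunkl_cos \<mu> (x * t))" "integrable ?D (\<lambda>t. dunkl_sin \<mu> (x * t))"
    using int by (intro integrable_dunkl_cos_sin[OF \<mu> finite_measure.finite_measure_distr[OF P]];
        simp add: integrable_distr_eq P)+
  then have "integrable P (\<lambda>t. dunkl_cos \<mu> (x * t))" "integrable P (\<lambda>t. dunkl_sin \<mu> (x * t))"
    by (simp_all add: integrable_distr_eq P)
  then show ?thesis by (simp add: dunkl_exp_i Complex_eq)
qed

theorem theorem3p8: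
  fixes \<mu> a :: real and \<nu> :: "real set \<Rightarrow> complex"
  assumes "\<mu> > -1/2"
    and "complex_measure (restrict_space borel {a..}) \<nu>"
    and "\<mu> \<ge> 0 \<Longrightarrow> emeasure (total_variation (restrict_space borel {a..}) \<nu>) {a..} < \<infinity>"
    and "\<mu> < 0 \<Longrightarrow>
           (\<integral>\<^sup>+ t. ennreal (\<bar>t\<bar> powr (-\<mu>) + 1) \<partial>total_variation (restrict_space borel {a..}) \<nu>) < \<infinity>"
    and "\<And>x::real. complex_measure_integral (restrict_space borel {a..}) \<nu>
           (\<lambda>t. dunkl_exp \<mu> (\<i> * complex_of_real x * complex_of_real t)) = 0"
  shows "complex_absolutely_continuous (restrict_space lborel {a..}) \<nu>"
proof -
  let ?M = "restrict_space borel {a..}" and ?k = "max 0 (-\<mu>)"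
  let ?T = "total_variation ?M \<nu>"
  have S: "{a..} \<in> sets borel" by simp
  have fin: "(\<integral>\<^sup>+t. ennreal (\<bar>t\<bar> powr ?k + 1) \<partial>?T) < \<infinity>"
  proof (cases "\<mu> \<ge> 0")
    case True
    have "(\<integral>\<^sup>+t. ennreal (\<bar>t\<bar> powr ?k + 1) \<partial>?T) \<le> (\<integral>\<^sup>+t. 2 \<partial>?T)"
      using True by (intro nn_integral_mono) (simp add: ennreal_le_iff flip: ennreal_numeral)
    also have "\<dots> = 2 * emeasure ?T (space ?T)" by simp
    also have "space ?T = space ?M"
      by (intro sets_eq_imp_space_eq sets_total_variation)
    also have "2 * emeasure ?T (space ?M) = 2 * emeasure ?T {a..}"
      by (simp add: space_restrict_space)
    also have "\<dots> < \<infinity>" using assms(3)[OF True] by (simp add: ennreal_mult_less_top)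
    finally show ?thesis .
  qed (use assms(4) in simp)
  define P where "P L = positive_part ?M (\<lambda>E. L (\<nu> E))" for L :: "complex \<Rightarrow> real"
  define c where "c L x = (\<integral>t. dunkl_cos \<mu> (x * t) \<partial>P L) - (\<integral>t. dunkl_cos \<mu> (x * t) \<partial>P (\<lambda>z. - L z))" for L x
  define s where "s L x = (\<integral>t. dunkl_sin \<mu> (x * t) \<partial>P L) - (\<integral>t. dunkl_sin \<mu> (x * t) \<partial>P (\<lambda>z. - L z))" for L x
  have signed: "signed_integral ?M (\<lambda>E. L (\<nu> E)) (\<lambda>t. dunkl_exp \<mu> (\<i> * of_real x * of_real t))
      = Complex (c L x) (s L x)"
    if L: "bounded_linear L" "\<And>z. \<bar>L z\<bar> \<le> cmod z" for L x
  proof -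
    have L': "bounded_linear (\<lambda>z. - L z)" "\<And>z. \<bar>- L z\<bar> \<le> cmod z"
      using L by (auto intro: bounded_linear_minus)
    note p = positive_part_properties[OF S assms(2) L fin refl]
      and q = positive_part_properties[OF S assms(2) L' fin refl]
    show ?thesis
      unfolding signed_integral_def c_def s_def P_def
        integral_dunkl_exp[OF assms(1) p(2,4,3)] integral_dunkl_exp[OF assms(1) q(2,4,3)]
      by (simp add: complex_eq_iff)
  qed
  have Re: "bounded_linear Re" "\<And>z. \<bar>Re z\<bar> \<le> cmod z"
    and Im: "bounded_linear Im" "\<And>z. \<bar>Im z\<bar> \<le> cmod z"
    by (auto simp: bounded_linear_Re bounded_linear_Im abs_Re_le_cmod abs_Im_le_cmod)
  have eqs: "c Re x = s Im x" "s Re x = - c Im x" for x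
    using assms(5)[of x] unfolding complex_measure_integral_def signed[OF Re] signed[OF Im]
    by (auto simp: complex_eq_iff)
  \<comment> \<open>The integral of the complex measure at \<open>x\<close> mixes the transforms of \<open>Re \<nu>\<close> and \<open>Im \<nu>\<close>. Comparing
    \<open>x\<close> with \<open>-x\<close> separates them by parity.\<close>
  have even: "c L (-x) = c L x" and odd: "s L (-x) = - s L x" for L x
    by (simp_all add: c_def s_def dunkl_cos_minus[OF assms(1)] dunkl_sin_minus[OF assms(1)])
  have zero: "c Re x = 0" "s Re x = 0" "c Im x = 0" "s Im x = 0" for x
    using eqs[of x] eqs[of "-x"] by (auto simp: even odd)
  have z: "L (\<nu> E) = 0" if L: "bounded_linear L" "\<And>z. \<bar>L z\<bar> \<le> cmod z"
    and "\<And>x. c L x = 0" "\<And>x. s L x = 0" and E: "E \<in> sets ?M" for L E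
    by (rule dunkl_transform_signed_zero[OF assms(1) S assms(2) L fin refl refl _ _ E])
       (use that(3,4) in \<open>simp_all add: c_def s_def P_def\<close>)
  have "\<nu> E = 0" if "E \<in> sets ?M" for E
    using z[OF Re zero(1,2) that] z[OF Im zero(3,4) that] by (simp add: complex_eq_iff)
  moreover have "sets (restrict_space lborel {a..}) = sets ?M"
    by (simp add: sets_restrict_space)
  ultimately show ?thesis
    by (auto simp: complex_absolutely_continuous_def null_sets_def)
qed

end
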